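(* Let $p,q\ge1$, $d=p+q$, let $\Sigma_1\in\mathbb{S}^p_\ge$ and $\Sigma_2\in\mathbb{S}^q_\ge$ be non-zero, and let $\Sigma\in\Gamma(\Sigma_1,\Sigma_2)$. Let $\lambda_1\ge\dots\ge\lambda_d\ge0$ be the eigenvalues of $\Sigma$, $\lambda_{1,1}\ge\dots\ge\lambda_{p,1}\ge0$ those of $\Sigma_1$ and $\lambda_{1,2}\ge\dots\ge\lambda_{q,2}\ge0$ those of $\Sigma_2$, with $\lambda_{j,1}=0$ for $j\ge p+1$ and $\lambda_{j,2}=0$ for $j\ge q+1$. With $\Sigma_0=\begin{bmatrix}\Sigma_1&0\\0&\Sigma_2\end{bmatrix}$ and $\Sigma_m$ as defined in the context, we have $$\mathfrak{D}_1(\Sigma)=\frac{\operatorname{tr}(\Sigma_1^{1/2})+\operatorname{tr}(\Sigma_2^{1/2})-\operatorname{tr}(\Sigma^{1/2})}{\operatorname{tr}(\Sigma_1^{1/2})+\operatorname{tr}(\Sigma_2^{1/2})-\operatorname{tr}(\Sigma_m^{1/2})}=\frac{\sum_{j=1}^p\lambda_{j,1}^{1/2}+\sum_{j=1}^q\lambda_{j,2}^{1/2}-\sum_{j=1}^d\lambda_j^{1/2}}{\sum_{j=1}^p\lambda_{j,1}^{1/2}+\sum_{j=1}^q\lambda_{j,2}^{1/2}-\sum_{j=1}^{p\vee q}(\lambda_{j,1}+\lambda_{j,2})^{1/2}}$$ and $$\mathfrak{D}_2(\Sigma)=\frac{\operatorname{tr}(\Sigma)-\operatorname{tr}\{(\Sigma_0^{1/2}\Sigma\Sigma_0^{1/2})^{1/2}\}}{\operatorname{tr}(\Sigma)-\operatorname{tr}\{(\Sigma_0^{1/2}\Sigma_m\Sigma_0^{1/2})^{1/2}\}}=\frac{\sum_{j=1}^d\lambda_j-\sum_{j=1}^d\kappa_j^{1/2}}{\sum_{j=1}^d\lambda_j-\sum_{j=1}^{p\vee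 q}(\lambda_{j,1}^2+\lambda_{j,2}^2)^{1/2}},$$ where $\kappa_1\ge\dots\ge\kappa_d\ge0$ denote the eigenvalues of $\Sigma_0^{1/2}\Sigma\Sigma_0^{1/2}$.
   Context: $\mathbb{S}^m_{\ge}$ is the set of real symmetric positive semi-definite $m\times m$ matrices; $p\vee q=\max(p,q)$. $\Gamma(\Sigma_1,\Sigma_2)$ is the set of all $\Sigma\in\mathbb{S}^{p+q}_{\ge}$ with upper left $p\times p$ diagonal block $\Sigma_1$ and lower right $q\times q$ diagonal block $\Sigma_2$. Eigenvalues are counted with multiplicity. The squared Bures--Wasserstein distance between $\Sigma,\Xi\in\mathbb{S}^d_\ge$ is $d_W^2(\Sigma,\Xi)=\operatorname{tr}(\Sigma)+\operatorname{tr}(\Xi)-2\operatorname{tr}\bigl((\Sigma^{1/2}\Xi\Sigma^{1/2})^{1/2}\bigr)$. The quasi-Gaussian Wasserstein dependence coefficients are $$\mathfrak{D}_1(\Sigma)=\frac{d_W^2(\Sigma,I_d)-d_W^2(\Sigma_1,I_p)-d_W^2(\Sigma_2,I_q)}{\sup_{\tilde\Sigma\in\Gamma(\Sigma_1,\Sigma_2)}d_W^2(\tilde\Sigma,I_d)-d_W^2(\Sigma_1,I_p)-d_W^2(\Sigma_2,I_q)},\qquad \mathfrak{D}_2(\Sigma)=\frac{d_W^2(\Sigma,\Sigma_0)}{\sup_{\tilde\Sigma\in\Gamma(\Sigma_1,\Sigma_2)}d_W^2(\tilde\Sigma,\Sigma_0)}.$$ Eigendecompositions: $\Sigma_j=U_j\Lambda_jU_j^\top$,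 $j\in\{1,2\}$, with $U_j$ orthogonal and $\Lambda_j$ diagonal containing the eigenvalues of $\Sigma_j$ in decreasing order. $\Sigma_m=\begin{bmatrix}\Sigma_1&\Psi_m\\ \Psi_m^\top&\Sigma_2\end{bmatrix}$ with $\Psi_m=U_1\Lambda_1^{1/2}\Pi\Lambda_2^{1/2}U_2^\top$, where $\Pi\in\mathbb{R}^{p\times q}$ is the $p\times q$ upper left block of $I_d$. *)

theory Defs
  imports "Jordan_Normal_Form.Char_Poly" Complex_Main
begin

definition mat_trace :: "real mat \<Rightarrow> real" where
  "mat_trace A = (\<Sum>i<dim_row A. A $$ (i, i))"

definition psd_mats :: "nat \<Rightarrow> real mat set" where
  "psd_mats n = {A \<in> carrier_mat n n. transpose_mat A = A \<and>
     (\<forall>v\<in>carrier_vec n. 0 \<le> v \<bullet> (A *\<^sub>v v))}"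

(* Meaningful only for A in psd_mats (dim_row A), where the root exists and is unique. *)
definition mat_sqrt :: "real mat \<Rightarrow> real mat" where
  "mat_sqrt A = (THE B. B \<in> psd_mats (dim_row A) \<and> B * B = A)"

(* Real eigenvalues with algebraic multiplicity, in decreasing order. For a real symmetric
   n x n matrix the characteristic polynomial splits over the reals, so there are n of them
   and the algebraic and geometric multiplicities coincide. *)
definition eigvals_desc :: "real mat \<Rightarrow> real list" where
  "eigvals_desc A = rev (sorted_list_of_multiset (proots (char_poly A)))"

(* Indices start at 0: eigval A j is the (j+1)-st largest eigenvalue,
   padded by 0 beyond the last one. *)
definition eigval :: "real mat \<Rightarrow> nat \<Rightarrow> real" where
  "eigval A j = (if j < length (eigvals_desc A) then eigvals_desc A ! j else 0)"

(* U has orthonormal columns. The library's orthogonal_mat does not normalise the columns. *)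
definition is_orthogonal :: "nat \<Rightarrow> real mat \<Rightarrow> bool" where
  "is_orthogonal n U \<longleftrightarrow> U \<in> carrier_mat n n \<and> transpose_mat U * U = 1\<^sub>m n"

definition eig_diag :: "real mat \<Rightarrow> real mat" where
  "eig_diag A = mat_diag (dim_row A) (eigval A)"

definition is_eigendecomp :: "real mat \<Rightarrow> real mat \<Rightarrow> bool" where
  "is_eigendecomp A U \<longleftrightarrow> is_orthogonal (dim_row A) U \<and> A = U * eig_diag A * transpose_mat U"

definition Gamma_set :: "real mat \<Rightarrow> real mat \<Rightarrow> real mat set" where
  "Gamma_set S1 S2 = {S \<in> psd_mats (dim_row S1 + dim_row S2).
     \<exists>B\<in>carrier_mat (dim_row S1) (dim_row S2). \<exists>C\<in>carrier_mat (dim_row S2) (dim_row S1).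
       S = four_block_mat S1 B C S2}"

definition bw_dist2 :: "real mat \<Rightarrow> real mat \<Rightarrow> real" where
  "bw_dist2 S X = mat_trace S + mat_trace X
     - 2 * mat_trace (mat_sqrt (mat_sqrt S * X * mat_sqrt S))"

definition Sigma_zero :: "real mat \<Rightarrow> real mat \<Rightarrow> real mat" where
  "Sigma_zero S1 S2 = four_block_mat S1 (0\<^sub>m (dim_row S1) (dim_row S2))
                        (0\<^sub>m (dim_row S2) (dim_row S1)) S2"

definition Pi_mat :: "nat \<Rightarrow> nat \<Rightarrow> real mat" where
  "Pi_mat p q = mat p q (\<lambda>ij. 1\<^sub>m (p + q) $$ ij)"

definition Psi_m :: "real mat \<Rightarrow> real mat \<Rightarrow> real mat \<Rightarrow> real mat \<Rightarrow> real mat" where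
  "Psi_m U1 U2 S1 S2 = U1 * mat_sqrt (eig_diag S1) * Pi_mat (dim_row S1) (dim_row S2)
                         * mat_sqrt (eig_diag S2) * transpose_mat U2"

definition Sigma_m :: "real mat \<Rightarrow> real mat \<Rightarrow> real mat \<Rightarrow> real mat \<Rightarrow> real mat" where
  "Sigma_m U1 U2 S1 S2 =
     four_block_mat S1 (Psi_m U1 U2 S1 S2) (transpose_mat (Psi_m U1 U2 S1 S2)) S2"

definition D1_denom :: "real mat \<Rightarrow> real mat \<Rightarrow> real" where
  "D1_denom S1 S2 =
     (SUP T\<in>Gamma_set S1 S2. bw_dist2 T (1\<^sub>m (dim_row S1 + dim_row S2)))
       - bw_dist2 S1 (1\<^sub>m (dim_row S1)) - bw_dist2 S2 (1\<^sub>m (dim_row S2))"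

definition D2_denom :: "real mat \<Rightarrow> real mat \<Rightarrow> real" where
  "D2_denom S1 S2 = (SUP T\<in>Gamma_set S1 S2. bw_dist2 T (Sigma_zero S1 S2))"

definition D1 :: "real mat \<Rightarrow> real mat \<Rightarrow> real mat \<Rightarrow> real" where
  "D1 S1 S2 S =
     (bw_dist2 S (1\<^sub>m (dim_row S1 + dim_row S2))
       - bw_dist2 S1 (1\<^sub>m (dim_row S1)) - bw_dist2 S2 (1\<^sub>m (dim_row S2))) / D1_denom S1 S2"

definition D2 :: "real mat \<Rightarrow> real mat \<Rightarrow> real mat \<Rightarrow> real" where
  "D2 S1 S2 S = bw_dist2 S (Sigma_zero S1 S2) / D2_denom S1 S2"

end

theory Submission
  imports Defs "Jordan_Normal_Form.Spectral_Radius"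
begin

text \<open>All matrices in \<open>\<Gamma>(\<Sigma>\<^sub>1, \<Sigma>\<^sub>2)\<close> have the same trace, so both numerators are
determined by a trace of a square root, and each supremum is attained where such a trace is smallest.
Both minimisations have one and the same reason.

Write \<open>T \<in> \<Gamma>(\<Sigma>\<^sub>1, \<Sigma>\<^sub>2)\<close> in the eigenbases of \<open>\<Sigma>\<^sub>1\<close> and \<open>\<Sigma>\<^sub>2\<close>, so that its diagonal blocks become
diagonal with the decreasing entries \<open>a\<^sub>j\<close> and \<open>b\<^sub>j\<close>. Ky Fan's maximum principle shows that the
eigenvalues of \<open>T\<close> are majorised by the sequence \<open>a\<^sub>j + b\<^sub>j\<close>, padded by zeros. The sum of square roots
is Schur-concave, so \<open>tr T\<^sup>1\<^sup>/\<^sup>2 \<ge> \<Sum>\<^sub>j (a\<^sub>j + b\<^sub>j)\<^sup>1\<^sup>/\<^sup>2\<close> (\<open>trace_sqrt_lower_bound\<close>). This settles the first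
coefficient. For the second, the trace of the root of \<open>T\<^sup>1\<^sup>/\<^sup>2 \<Sigma>\<^sub>0 T\<^sup>1\<^sup>/\<^sup>2\<close> equals that of the root of
\<open>\<Sigma>\<^sub>0\<^sup>1\<^sup>/\<^sup>2 T \<Sigma>\<^sub>0\<^sup>1\<^sup>/\<^sup>2\<close> (\<open>trace_sqrt_fidelity_commute\<close>), and the latter matrix lies in
\<open>\<Gamma>(\<Sigma>\<^sub>1\<^sup>2, \<Sigma>\<^sub>2\<^sup>2)\<close>, so the same inequality bounds it by \<open>\<Sum>\<^sub>j (a\<^sub>j\<^sup>2 + b\<^sub>j\<^sup>2)\<^sup>1\<^sup>/\<^sup>2\<close>.

The matrix \<open>\<Sigma>\<^sub>m\<close> attains both bounds. In the eigenbases it is \<open>W W\<^sup>T\<close>, where \<open>W\<close> is \<open>diag(\<surd>a)\<close> stacked on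
\<open>diag(\<surd>b)\<close>. The columns of \<open>W\<close> are orthogonal with squared norms \<open>a\<^sub>j + b\<^sub>j\<close>, and these are the
eigenvalues of \<open>\<Sigma>\<^sub>m\<close>; multiplication by \<open>\<Sigma>\<^sub>0\<^sup>1\<^sup>/\<^sup>2\<close> turns them into \<open>a\<^sub>j\<^sup>2 + b\<^sub>j\<^sup>2\<close>
(\<open>trace_sqrt_gram_diag\<close>). The denominators are positive since \<open>\<surd>(x + y) < \<surd>x + \<surd>y\<close> for positive \<open>x\<close>, \<open>y\<close>, and
the largest eigenvalues \<open>a\<^sub>0\<close>, \<open>b\<^sub>0\<close> are positive.\<close>

section \<open>Entries, traces and orthogonal matrices\<close>

lemma index_mult_mat_sum:
  assumes "A \<in> carrier_mat n m" "B \<in> carrier_mat m k" "i < n" "j < k"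
  shows "(A * B) $$ (i, j) = (\<Sum>l<m. A $$ (i, l) * B $$ (l, j))"
  using assms by (auto simp: scalar_prod_def lessThan_atLeast0 intro!: sum.cong)

lemma index_mult_mat_vec_sum:
  assumes "A \<in> carrier_mat n m" "v \<in> carrier_vec m" "i < n"
  shows "(A *\<^sub>v v) $ i = (\<Sum>l<m. A $$ (i, l) * v $ l)"
  using assms by (auto simp: scalar_prod_def lessThan_atLeast0 intro!: sum.cong)

lemma mat_trace_sum: "A \<in> carrier_mat n n \<Longrightarrow> mat_trace A = (\<Sum>i<n. A $$ (i, i))"
  by (auto simp: mat_trace_def)

lemma mat_trace_commute:
  assumes A: "A \<in> carrier_mat n m" and B: "B \<in> carrier_mat m n"
  shows "mat_trace (A * B) = mat_trace (B * A)"
proof -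
  have "mat_trace (A * B) = (\<Sum>i<n. \<Sum>l<m. A $$ (i, l) * B $$ (l, i))"
    using A B by (simp add: mat_trace_sum[of _ n] index_mult_mat_sum[OF A B] del: index_mult_mat(1))
  also have "\<dots> = (\<Sum>l<m. \<Sum>i<n. B $$ (l, i) * A $$ (i, l))"
    by (subst sum.swap) (simp add: mult.commute)
  also have "\<dots> = mat_trace (B * A)"
    using A B by (simp add: mat_trace_sum[of _ m] index_mult_mat_sum[OF B A] del: index_mult_mat(1))
  finally show ?thesis .
qed

lemma mat_trace_mat_diag: "mat_trace (mat_diag n f) = (\<Sum>i<n. f i)"
  by (simp add: mat_trace_def mat_diag_def)

lemma transpose_mat_diag [simp]: "transpose_mat (mat_diag n f) = mat_diag n f"
  by (rule eq_matI) (auto simp: mat_diag_def)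

lemma block_diag_mult:
  fixes A :: "'a :: comm_ring_1 mat"
  assumes "A \<in> carrier_mat n m" "B \<in> carrier_mat n' m'"
    and "C \<in> carrier_mat m k" "D \<in> carrier_mat m' k'"
  shows "four_block_mat A (0\<^sub>m n m') (0\<^sub>m n' m) B * four_block_mat C (0\<^sub>m m k') (0\<^sub>m m' k) D =
    four_block_mat (A * C) (0\<^sub>m n k') (0\<^sub>m n' k) (B * D)"
  using assms
  by (subst mult_four_block_mat[of _ n m _ m' _ n' _ _ k _ k']) auto

text \<open>The square case, in which the conclusion determines every dimension in the premises.\<close>

lemma mult_carrier_square:
  "A \<in> carrier_mat n n \<Longrightarrow> B \<in> carrier_mat n n \<Longrightarrow> A * B \<in> carrier_mat n n"
  by simp

lemma is_orthogonalD:
  assumes "is_orthogonal n U"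
  shows "U \<in> carrier_mat n n" "transpose_mat U \<in> carrier_mat n n"
    "transpose_mat U * U = 1\<^sub>m n" "U * transpose_mat U = 1\<^sub>m n"
  using assms mat_mult_left_right_inverse[of "transpose_mat U" n U]
  by (auto simp: is_orthogonal_def)

lemma is_orthogonal_mult:
  assumes U: "is_orthogonal n U" and V: "is_orthogonal n V"
  shows "is_orthogonal n (U * V)"
proof -
  note u = is_orthogonalD[OF U] and v = is_orthogonalD[OF V]
  have "transpose_mat (U * V) * (U * V) = transpose_mat V * ((transpose_mat U * U) * V)"
    using u(1,2) v(1,2) by (simp add: transpose_mult[of _ n n _ n] assoc_mult_mat[of _ n n _ n _ n])
  also have "\<dots> = 1\<^sub>m n" unfolding u(3) using v by simp
  finally show ?thesis using u(1) v(1) by (simp add: is_orthogonal_def)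
qed

section \<open>The spectral theorem for real symmetric matrices\<close>

text \<open>The eigenvalue comes from the complex numbers. Split a complex eigenvector into real and imaginary
parts \<open>x\<close>, \<open>y\<close>. Symmetry gives \<open>\<langle>A x, y\<rangle> = \<langle>x, A y\<rangle>\<close>, which forces the imaginary part of
the eigenvalue times \<open>|x|\<^sup>2 + |y|\<^sup>2\<close> to vanish; then \<open>A\<close> multiplies both \<open>x\<close> and \<open>y\<close> by the
same real number, and one of them is non-zero.\<close>

lemma real_symmetric_eigenvector:
  fixes A :: "real mat"
  assumes A: "A \<in> carrier_mat n n" and sym: "transpose_mat A = A" and n: "n > 0"
  shows "\<exists>e v. v \<in> carrier_vec n \<and> v \<noteq> 0\<^sub>v n \<and> A *\<^sub>v v = e \<cdot>\<^sub>v v"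
proof -
  let ?C = "map_mat complex_of_real A"
  have C: "?C \<in> carrier_mat n n" using A by simp
  from spectrum_non_empty[OF C n] obtain k where "eigenvalue ?C k"
    by (auto simp: spectrum_def)
  then obtain z where z: "z \<in> carrier_vec n" "z \<noteq> 0\<^sub>v n" "?C *\<^sub>v z = k \<cdot>\<^sub>v z"
    using A by (auto simp: eigenvalue_def eigenvector_def)
  define x where "x = map_vec Re z"
  define y where "y = map_vec Im z"
  have xy: "x \<in> carrier_vec n" "y \<in> carrier_vec n" using z by (auto simp: x_def y_def)
  have entry: "(\<Sum>j<n. complex_of_real (A $$ (i, j)) * z $ j) = k * z $ i" if "i < n" for i
  proof -
    have "(?C *\<^sub>v z) $ i = (\<Sum>j<n. ?C $$ (i, j) * z $ j)"
      by (rule index_mult_mat_vec_sum[OF C z(1) that])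
    also have "\<dots> = (\<Sum>j<n. complex_of_real (A $$ (i, j)) * z $ j)"
      using A that by (intro sum.cong) auto
    finally show ?thesis using z that by simp
  qed
  have Ax: "A *\<^sub>v x = Re k \<cdot>\<^sub>v x - Im k \<cdot>\<^sub>v y"
  proof (rule eq_vecI)
    fix i assume "i < dim_vec (Re k \<cdot>\<^sub>v x - Im k \<cdot>\<^sub>v y)"
    then have i: "i < n" using xy by simp
    have "(A *\<^sub>v x) $ i = Re (\<Sum>j<n. complex_of_real (A $$ (i, j)) * z $ j)"
      unfolding index_mult_mat_vec_sum[OF A xy(1) i] using z by (simp add: x_def)
    then show "(A *\<^sub>v x) $ i = (Re k \<cdot>\<^sub>v x - Im k \<cdot>\<^sub>v y) $ i"
      using i z by (simp add: entry x_def y_def)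
  qed (use A xy in auto)
  have Ay: "A *\<^sub>v y = Im k \<cdot>\<^sub>v x + Re k \<cdot>\<^sub>v y"
  proof (rule eq_vecI)
    fix i assume "i < dim_vec (Im k \<cdot>\<^sub>v x + Re k \<cdot>\<^sub>v y)"
    then have i: "i < n" using xy by simp
    have "(A *\<^sub>v y) $ i = Im (\<Sum>j<n. complex_of_real (A $$ (i, j)) * z $ j)"
      unfolding index_mult_mat_vec_sum[OF A xy(2) i] using z by (simp add: y_def)
    then show "(A *\<^sub>v y) $ i = (Im k \<cdot>\<^sub>v x + Re k \<cdot>\<^sub>v y) $ i"
      using i z by (simp add: entry x_def y_def)
  qed (use A xy in auto)
  have "(A *\<^sub>v x) \<bullet> y = x \<bullet> (A *\<^sub>v y)"
    using transpose_vec_mult_scalar[OF A xy(2,1)] sym by simp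
  moreover have "(A *\<^sub>v x) \<bullet> y = Re k * (x \<bullet> y) - Im k * (y \<bullet> y)"
    unfolding Ax using xy by (simp add: minus_scalar_prod_distrib[of _ n])
  moreover have "x \<bullet> (A *\<^sub>v y) = Im k * (x \<bullet> x) + Re k * (x \<bullet> y)"
    unfolding Ay using xy by (simp add: scalar_prod_add_distrib[of _ n])
  ultimately have im: "Im k * (x \<bullet> x + y \<bullet> y) = 0" by (simp add: algebra_simps)
  have norm0: "v \<bullet> v = 0 \<longleftrightarrow> v = 0\<^sub>v n" if "v \<in> carrier_vec n" for v :: "real vec"
  proof
    assume "v \<bullet> v = 0"
    then have "(\<Sum>i<n. v $ i * v $ i) = 0" using that by (simp add: scalar_prod_def lessThan_atLeast0)
    then have "\<forall>i<n. v $ i = 0" by (subst (asm) sum_nonneg_eq_0_iff) auto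
    then show "v = 0\<^sub>v n" using that by (intro eq_vecI) auto
  qed (use that in auto)
  have nonneg: "0 \<le> v \<bullet> v" for v :: "real vec"
    by (simp add: scalar_prod_def sum_nonneg)
  have nz: "x \<noteq> 0\<^sub>v n \<or> y \<noteq> 0\<^sub>v n"
  proof (rule ccontr)
    assume "\<not> ?thesis"
    then have *: "x = 0\<^sub>v n" "y = 0\<^sub>v n" by auto
    have "Re (z $ i) = 0" "Im (z $ i) = 0" if "i < n" for i
      using arg_cong[OF *(1), of "\<lambda>v. v $ i"] arg_cong[OF *(2), of "\<lambda>v. v $ i"] that z(1)
      by (auto simp: x_def y_def)
    then have "z = 0\<^sub>v n" using z(1) by (intro eq_vecI) (auto simp: complex_eq_iff)
    with z show False by simp
  qed
  then have "x \<bullet> x + y \<bullet> y \<noteq> 0"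
    using nonneg[of x] nonneg[of y] norm0[OF xy(1)] norm0[OF xy(2)]
    by (auto simp: add_nonneg_eq_0_iff)
  with im have "Im k = 0" by simp
  then have "A *\<^sub>v x = Re k \<cdot>\<^sub>v x" "A *\<^sub>v y = Re k \<cdot>\<^sub>v y"
    unfolding Ax Ay using xy by (auto intro!: eq_vecI)
  with nz xy show ?thesis by blast
qed

text \<open>The Householder reflection exchanging the first unit vector and \<open>v\<close> completes \<open>v\<close> to an orthonormal
basis by an explicit formula. Since \<open>|v| = 1\<close>, the vector \<open>w = e\<^sub>0 - v\<close> has squared norm
\<open>2 (1 - v\<^sub>0) = 2 s\<close>, so the reflection is \<open>1 - w w\<^sup>T / s\<close>. If \<open>v = e\<^sub>0\<close> then \<open>s = 0\<close>, and
\<open>x / 0 = 0\<close> turns the formula into the identity, as it should.\<close>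

lemma householder_first_column:
  assumes v: "v \<in> carrier_vec n" and n: "0 < n" and norm: "(\<Sum>i<n. (v $ i)\<^sup>2) = (1::real)"
  shows "\<exists>H. is_orthogonal n H \<and> transpose_mat H = H \<and> col H 0 = v"
proof -
  define w where "w i = (if i = 0 then 1 else 0) - v $ i" for i
  define s where "s = 1 - v $ 0"
  define H where "H = mat n n (\<lambda>(i, j). (if i = j then 1 else 0) - w i * w j / s)"
  have H: "H \<in> carrier_mat n n" by (simp add: H_def)
  have ww: "(\<Sum>i<n. w i * w i) = 2 * s"
  proof -
    have "w i * w i = (if i = 0 then 1 else 0) - 2 * (if i = 0 then v $ i else 0) + (v $ i)\<^sup>2" for i
      by (simp add: w_def power2_eq_square algebra_simps)
    then have "(\<Sum>i<n. w i * w i) = 1 - 2 * v $ 0 + 1"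
      using n norm by (simp add: sum.distrib sum_subtractf flip: sum_distrib_left)
    then show ?thesis by (simp add: s_def)
  qed
  have w0: "w i = 0" if "s = 0" "i < n" for i
  proof -
    have "(\<Sum>i<n. w i * w i) = 0" using ww that by simp
    then have "\<forall>i<n. w i = 0" by (subst (asm) sum_nonneg_eq_0_iff) auto
    with that show ?thesis by simp
  qed
  have sym: "transpose_mat H = H" by (rule eq_matI) (auto simp: H_def)
  have "H * H = 1\<^sub>m n"
  proof (rule eq_matI)
    fix i j assume "i < dim_row (1\<^sub>m n :: real mat)" "j < dim_col (1\<^sub>m n :: real mat)"
    then have ij: "i < n" "j < n" by auto
    have "(H * H) $$ (i, j) = (\<Sum>l<n. ((if i = l then 1 else 0) - w i * w l / s)
        * ((if l = j then 1 else 0) - w l * w j / s))"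
      unfolding index_mult_mat_sum[OF H H ij] using ij by (intro sum.cong) (auto simp: H_def)
    also have "\<dots> = (\<Sum>l<n. (if l = i then (if i = j then 1 else 0) else 0) - (if l = i then w i * w j / s else 0)
        - (if l = j then w i * w j / s else 0) + w i * w j / s / s * (w l * w l))"
      by (intro sum.cong) (auto simp: algebra_simps)
    also have "\<dots> = (if i = j then 1 else 0) - 2 * (w i * w j / s) + w i * w j / s / s * (2 * s)"
      using ij by (simp only: sum.distrib sum_subtractf sum_distrib_left[symmetric] ww) simp
    also have "\<dots> = (if i = j then 1 else 0)" by (cases "s = 0") auto
    finally show "(H * H) $$ (i, j) = (1\<^sub>m n) $$ (i, j)" using ij by simp
  qed (use H in auto)
  moreover have "col H 0 = v"
  proof (rule eq_vecI)
    fix i assume "i < dim_vec v"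
    then have i: "i < n" using v by simp
    have "col H 0 $ i = (if i = 0 then 1 else 0) - w i * w 0 / s"
      using i n by (simp add: H_def)
    also have "\<dots> = v $ i"
    proof (cases "s = 0")
      case True
      with w0[OF True i] show ?thesis by (simp add: w_def)
    next
      case False
      then show ?thesis by (simp add: w_def s_def)
    qed
    finally show "col H 0 $ i = v $ i" .
  qed (use H v in auto)
  ultimately show ?thesis using H sym by (auto simp: is_orthogonal_def)
qed

lemma char_poly_orthogonal_conj:
  assumes U: "is_orthogonal n U" and B: "B \<in> carrier_mat n n"
  shows "char_poly (U * B * transpose_mat U) = char_poly B"
  by (rule char_poly_similar, rule similar_matI[of _ _ U "transpose_mat U" n])
    (use is_orthogonalD[OF U] B in auto)

lemma char_poly_one_by_one: "char_poly (mat 1 1 (\<lambda>_. e)) = [:-e, 1:]"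
  by (simp add: char_poly_defs det_single)

text \<open>Conjugating by a reflection whose first column is the normalised eigenvector makes the first column
of \<open>A\<close> equal to \<open>e\<close> times the first unit vector; by symmetry the first row is of the same form. What
remains is a symmetric matrix of one dimension less, whose characteristic polynomial has lost exactly
the factor of \<open>e\<close>.\<close>

lemma symmetric_deflation:
  fixes A :: "real mat"
  assumes A: "A \<in> carrier_mat (Suc n) (Suc n)" and sym: "transpose_mat A = A"
    and v: "v \<in> carrier_vec (Suc n)" "v \<noteq> 0\<^sub>v (Suc n)" "A *\<^sub>v v = e \<cdot>\<^sub>v v"
  shows "\<exists>H B. is_orthogonal (Suc n) H \<and> B \<in> carrier_mat n n \<and> transpose_mat B = B \<and>
    A = H * four_block_mat (mat 1 1 (\<lambda>_. e)) (0\<^sub>m 1 n) (0\<^sub>m n 1) B * transpose_mat H \<and>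
    char_poly A = [:-e, 1:] * char_poly B"
proof -
  let ?N = "Suc n"
  define r where "r = sqrt (\<Sum>i<?N. (v $ i)\<^sup>2)"
  have "(\<Sum>i<?N. (v $ i)\<^sup>2) \<noteq> 0"
  proof
    assume "(\<Sum>i<?N. (v $ i)\<^sup>2) = 0"
    then have "\<forall>i\<in>{..<?N}. (v $ i)\<^sup>2 = 0" by (subst (asm) sum_nonneg_eq_0_iff) auto
    then have "v = 0\<^sub>v ?N" using v(1) by (intro eq_vecI) auto
    with v show False by simp
  qed
  then have r2: "r\<^sup>2 = (\<Sum>i<?N. (v $ i)\<^sup>2)" and r: "r \<noteq> 0"
    by (auto simp: r_def sum_nonneg simp del: sum.lessThan_Suc)
  define u where "u = (1 / r) \<cdot>\<^sub>v v"
  have u: "u \<in> carrier_vec ?N" using v by (simp add: u_def)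
  have "(\<Sum>i<?N. (u $ i)\<^sup>2) = (\<Sum>i<?N. (v $ i)\<^sup>2 / r\<^sup>2)"
    using v by (intro sum.cong) (auto simp: u_def power_divide)
  also have "\<dots> = 1" using r unfolding sum_divide_distrib[symmetric] r2[symmetric] by simp
  finally obtain H where H: "is_orthogonal ?N H" "transpose_mat H = H" "col H 0 = u"
    using householder_first_column[OF u] by auto
  have Au: "A *\<^sub>v u = e \<cdot>\<^sub>v u"
    using mult_mat_vec[OF A v(1), of "1 / r"] v(3)
    by (simp add: u_def smult_smult_assoc mult.commute)
  note h = is_orthogonalD[OF H(1)]
  define M where "M = H * A * H"
  have M: "M \<in> carrier_mat ?N ?N" using h(1) A by (simp add: M_def)
  have symM: "transpose_mat M = M"
    using h(1) A sym H(2)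
    by (simp add: M_def transpose_mult[of _ ?N ?N _ ?N] assoc_mult_mat[of _ ?N ?N _ ?N _ ?N])
  have AM: "A = H * M * transpose_mat H"
  proof -
    have "H * M * transpose_mat H = (H * H) * A * (H * H)"
      using h(1) A by (simp add: M_def H(2) assoc_mult_mat[of _ ?N ?N _ ?N _ ?N])
    also have "\<dots> = A" using h(3) A by (simp add: H(2))
    finally show ?thesis ..
  qed
  have "H *\<^sub>v u = unit_vec ?N 0"
  proof -
    have "H *\<^sub>v u = col (H * H) 0" by (simp only: col_mult2[OF h(1) h(1) zero_less_Suc] H(3))
    also have "\<dots> = unit_vec ?N 0" using h(3) by (simp add: H(2))
    finally show ?thesis .
  qed
  then have colM: "col M 0 = e \<cdot>\<^sub>v unit_vec ?N 0"
    unfolding M_def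
    by (simp only: col_mult2[OF mult_carrier_mat[OF h(1) A] h(1) zero_less_Suc] H(3)
        assoc_mult_mat_vec[OF h(1) A u] Au mult_mat_vec[OF h(1) u])
  have M0: "M $$ (i, 0) = (if i = 0 then e else 0)" if "i < ?N" for i
    using arg_cong[OF colM, of "\<lambda>v. v $ i"] that M by (auto simp: unit_vec_def)
  have M0': "M $$ (0, i) = (if i = 0 then e else 0)" if "i < ?N" for i
    using arg_cong[OF symM, of "\<lambda>B. B $$ (i, 0)"] M0[OF that] that M by simp
  define B where "B = mat n n (\<lambda>(i, j). M $$ (Suc i, Suc j))"
  have B: "B \<in> carrier_mat n n" by (simp add: B_def)
  have "transpose_mat B = B"
  proof (rule eq_matI)
    fix i j assume "i < dim_row B" "j < dim_col B"
    then show "transpose_mat B $$ (i, j) = B $$ (i, j)"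
      using arg_cong[OF symM, of "\<lambda>B. B $$ (Suc i, Suc j)"] M by (simp add: B_def)
  qed (auto simp: B_def)
  moreover have MB: "M = four_block_mat (mat 1 1 (\<lambda>_. e)) (0\<^sub>m 1 n) (0\<^sub>m n 1) B"
  proof (rule eq_matI)
    fix i j
    assume "i < dim_row (four_block_mat (mat 1 1 (\<lambda>_. e)) (0\<^sub>m 1 n) (0\<^sub>m n 1) B)"
      "j < dim_col (four_block_mat (mat 1 1 (\<lambda>_. e)) (0\<^sub>m 1 n) (0\<^sub>m n 1) B)"
    then have ij: "i < ?N" "j < ?N" by (auto simp: B_def)
    then show "M $$ (i, j) = four_block_mat (mat 1 1 (\<lambda>_. e)) (0\<^sub>m 1 n) (0\<^sub>m n 1) B $$ (i, j)"
      using M0[of i] M0'[of j] by (cases i; cases j) (auto simp: B_def)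
  qed (use M B in auto)
  moreover have "char_poly A = [:-e, 1:] * char_poly B"
  proof -
    have "char_poly A = char_poly M"
      unfolding AM by (rule char_poly_orthogonal_conj[OF H(1) M])
    also have "\<dots> = char_poly (mat 1 1 (\<lambda>_. e)) * char_poly B"
      unfolding MB by (rule char_poly_four_block_zeros_col[OF _ _ B]) auto
    finally show ?thesis unfolding char_poly_one_by_one .
  qed
  ultimately show ?thesis using H(1) AM B by blast
qed

lemma symmetric_char_poly_splits:
  fixes A :: "real mat"
  assumes "A \<in> carrier_mat n n" and "transpose_mat A = A"
  shows "\<exists>es. length es = n \<and> char_poly A = (\<Prod>e\<leftarrow>es. [:-e, 1:])"
  using assms
proof (induction n arbitrary: A)
  case 0
  then have "char_poly A = 1" by (simp add: char_poly_defs det_dim_zero)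
  then show ?case by simp
next
  case (Suc n)
  obtain e v where "v \<in> carrier_vec (Suc n)" "v \<noteq> 0\<^sub>v (Suc n)" "A *\<^sub>v v = e \<cdot>\<^sub>v v"
    using real_symmetric_eigenvector[OF Suc.prems] by auto
  from symmetric_deflation[OF Suc.prems this] obtain B where
    B: "B \<in> carrier_mat n n" "transpose_mat B = B" "char_poly A = [:-e, 1:] * char_poly B" by blast
  from Suc.IH[OF B(1,2)] obtain es where "length es = n" "char_poly B = (\<Prod>e\<leftarrow>es. [:-e, 1:])" by blast
  with B(3) show ?case by (intro exI[of _ "e # es"]) simp
qed

text \<open>The list \<open>es\<close> is an arbitrary ordering of the roots: deflation may begin with any eigenvalue. Hence
the eigenvalues can be placed on the diagonal in decreasing order from the start.\<close>

lemma symmetric_diagonalization: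
  fixes A :: "real mat"
  assumes "A \<in> carrier_mat n n" and "transpose_mat A = A"
    and "length es = n" and "char_poly A = (\<Prod>e\<leftarrow>es. [:-e, 1:])"
  shows "\<exists>U. is_orthogonal n U \<and> A = U * mat_diag n (\<lambda>i. es ! i) * transpose_mat U"
  using assms
proof (induction n arbitrary: A es)
  case 0
  then have "is_orthogonal 0 A \<and> A = A * mat_diag 0 (\<lambda>i. es ! i) * transpose_mat A"
    by (auto simp: is_orthogonal_def intro!: eq_matI)
  then show ?case by blast
next
  case (Suc n)
  then obtain e es' where es: "es = e # es'" and len: "length es' = n" by (cases es) auto
  let ?N = "Suc n"
  have "eigenvalue A e"
    using Suc.prems(4) by (subst eigenvalue_root_char_poly[OF Suc.prems(1)]) (simp add: es)
  then obtain v where v: "v \<in> carrier_vec ?N" "v \<noteq> 0\<^sub>v ?N" "A *\<^sub>v v = e \<cdot>\<^sub>v v"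
    using Suc.prems(1) by (auto simp: eigenvalue_def eigenvector_def)
  from symmetric_deflation[OF Suc.prems(1,2) v] obtain H B where
    H: "is_orthogonal ?N H" and B: "B \<in> carrier_mat n n" "transpose_mat B = B"
    and AH: "A = H * four_block_mat (mat 1 1 (\<lambda>_. e)) (0\<^sub>m 1 n) (0\<^sub>m n 1) B * transpose_mat H"
    and cp: "char_poly A = [:-e, 1:] * char_poly B" by blast
  have "[:-e, 1:] * char_poly B = [:-e, 1:] * (\<Prod>e\<leftarrow>es'. [:-e, 1:])"
    using cp Suc.prems(4) by (simp add: es)
  then have "char_poly B = (\<Prod>e\<leftarrow>es'. [:-e, 1:])"
    by (metis mult_cancel_left one_neq_zero pCons_eq_0_iff)
  from Suc.IH[OF B len this] obtain V where V: "is_orthogonal n V"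
    and BV: "B = V * mat_diag n (\<lambda>i. es' ! i) * transpose_mat V" by blast
  note h = is_orthogonalD[OF H] and vv = is_orthogonalD[OF V]
  define W where "W = four_block_mat (1\<^sub>m 1) (0\<^sub>m 1 n) (0\<^sub>m n 1) V"
  have W: "W \<in> carrier_mat ?N ?N" using four_block_carrier_mat[OF one_carrier_mat[of 1] vv(1)]
    by (simp add: W_def)
  have WT: "transpose_mat W = four_block_mat (1\<^sub>m 1) (0\<^sub>m 1 n) (0\<^sub>m n 1) (transpose_mat V)"
    unfolding W_def using vv(1) by (subst transpose_four_block_mat[of _ 1 1 _ n _ n]) auto
  have "transpose_mat W * W = four_block_mat (1\<^sub>m 1) (0\<^sub>m 1 n) (0\<^sub>m n 1) (1\<^sub>m n)"
    unfolding WT unfolding W_def using vv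
    by (subst block_diag_mult[of _ 1 1 _ n n _ 1 _ n]) auto
  also have "\<dots> = 1\<^sub>m ?N" by simp
  finally have oW: "is_orthogonal ?N W" using W by (simp add: is_orthogonal_def)
  have D: "mat_diag ?N (\<lambda>i. es ! i) =
      four_block_mat (mat 1 1 (\<lambda>_. e)) (0\<^sub>m 1 n) (0\<^sub>m n 1) (mat_diag n (\<lambda>i. es' ! i))"
    by (rule eq_matI) (auto simp: mat_diag_def es nth_Cons')
  let ?E = "mat 1 1 (\<lambda>_. e)" and ?D = "mat_diag n (\<lambda>i. es' ! i)"
  have E: "?E \<in> carrier_mat 1 1" and D': "?D \<in> carrier_mat n n" by simp_all
  have "W * mat_diag ?N (\<lambda>i. es ! i) = four_block_mat (1\<^sub>m 1 * ?E) (0\<^sub>m 1 n) (0\<^sub>m n 1) (V * ?D)"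
    unfolding D unfolding W_def by (rule block_diag_mult[OF one_carrier_mat vv(1) E D'])
  also have "\<dots> * transpose_mat W =
      four_block_mat (1\<^sub>m 1 * ?E * 1\<^sub>m 1) (0\<^sub>m 1 n) (0\<^sub>m n 1) (V * ?D * transpose_mat V)"
    unfolding WT
    by (rule block_diag_mult[OF mult_carrier_mat[OF one_carrier_mat E]
          mult_carrier_mat[OF vv(1) D'] one_carrier_mat vv(2)])
  finally have BW: "four_block_mat ?E (0\<^sub>m 1 n) (0\<^sub>m n 1) B = W * mat_diag ?N (\<lambda>i. es ! i) * transpose_mat W"
    by (simp only: BV left_mult_one_mat[OF E] right_mult_one_mat[OF E])
  have "A = (H * W) * mat_diag ?N (\<lambda>i. es ! i) * transpose_mat (H * W)"
    unfolding AH BW using h(1,2) W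
    by (simp add: transpose_mult[of _ ?N ?N _ ?N] assoc_mult_mat[of _ ?N ?N _ ?N _ ?N] mult_carrier_square)
  with is_orthogonal_mult[OF H oW] show ?case by blast
qed

section \<open>Eigenvalues and square roots of positive semi-definite matrices\<close>

lemma mult_conj_conj:
  fixes D E :: "'a :: semiring_0 mat"
  assumes "Y \<in> carrier_mat n m" "Z \<in> carrier_mat m n" "D \<in> carrier_mat m m" "E \<in> carrier_mat m m"
  shows "(Y * D * Z) * (Y * E * Z) = Y * (D * (Z * Y) * E) * Z"
proof -
  note 1 = mult_carrier_mat[OF assms(3,2)] and 2 = mult_carrier_mat[OF assms(4,2)]
    and 3 = mult_carrier_mat[OF assms(2,1)]
  have "(Y * D * Z) * (Y * E * Z) = Y * (D * Z) * (Y * (E * Z))"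
    by (simp only: assoc_mult_mat[OF assms(1,3,2)] assoc_mult_mat[OF assms(1,4,2)])
  also have "\<dots> = Y * (D * (Z * (Y * (E * Z))))"
    by (simp only: assoc_mult_mat[OF assms(1) 1 mult_carrier_mat[OF assms(1) 2]]
        assoc_mult_mat[OF assms(3,2) mult_carrier_mat[OF assms(1) 2]])
  also have "Z * (Y * (E * Z)) = (Z * Y * E) * Z"
    by (simp only: assoc_mult_mat[OF 3 assms(4,2)] assoc_mult_mat[OF assms(2,1) 2])
  also have "Y * (D * (Z * Y * E * Z)) = Y * (D * (Z * Y * E)) * Z"
    using mult_carrier_mat[OF 3 assms(4)]
    by (simp only: assoc_mult_mat[OF assms(1) mult_carrier_mat[OF assms(3)] assms(2)]
        assoc_mult_mat[OF assms(3) _ assms(2)])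
  also have "D * (Z * Y * E) = D * (Z * Y) * E"
    by (simp only: assoc_mult_mat[OF assms(3) 3 assms(4)])
  finally show ?thesis .
qed

lemma proots_prod_linear: "proots (\<Prod>e\<leftarrow>es. [:-e, 1:]) = mset (es :: real list)"
proof (induction es)
  case (Cons e es)
  have "(\<Prod>e\<leftarrow>es. [:-e, 1:]) \<noteq> (0 :: real poly)" by (auto simp: prod_list_zero_iff)
  then have "proots ([:-e, 1:] * (\<Prod>e\<leftarrow>es. [:-e, 1:])) =
      proots [:-e, 1:] + proots (\<Prod>e\<leftarrow>es. [:-e, 1:])"
    by (intro proots_mult) auto
  then show ?case using Cons.IH by (simp del: mult_pCons_left)
qed simp

lemma mset_eigvals_desc:
  assumes "char_poly A = (\<Prod>e\<leftarrow>es. [:-e, 1:])"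
  shows "mset (eigvals_desc A) = mset es"
  using assms by (simp add: eigvals_desc_def proots_prod_linear)

lemma symmetric_eigendecomp:
  assumes A: "A \<in> carrier_mat n n" "transpose_mat A = A"
  shows "length (eigvals_desc A) = n" "\<exists>U. is_eigendecomp A U"
proof -
  from symmetric_char_poly_splits[OF A] obtain es
    where es: "length es = n" "char_poly A = (\<Prod>e\<leftarrow>es. [:-e, 1:])" by blast
  have ms: "mset (eigvals_desc A) = mset es" by (rule mset_eigvals_desc[OF es(2)])
  then show len: "length (eigvals_desc A) = n" using es(1) by (metis size_mset)
  have "char_poly A = prod_mset (image_mset (\<lambda>e. [:-e, 1:]) (mset es))"
    by (simp add: es(2) prod_mset_prod_list[symmetric])
  also have "\<dots> = (\<Prod>e\<leftarrow>eigvals_desc A. [:-e, 1:])"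
    by (simp add: ms[symmetric] prod_mset_prod_list[symmetric])
  finally obtain U where
    "is_orthogonal n U" "A = U * mat_diag n (\<lambda>i. eigvals_desc A ! i) * transpose_mat U"
    using symmetric_diagonalization[OF A len] by blast
  moreover have "mat_diag n (\<lambda>i. eigvals_desc A ! i) = eig_diag A"
    using A len by (auto simp: eig_diag_def mat_diag_def eigval_def intro!: eq_matI)
  ultimately show "\<exists>U. is_eigendecomp A U" using A by (auto simp: is_eigendecomp_def)
qed

lemma is_eigendecompD:
  assumes "is_eigendecomp A U" "A \<in> carrier_mat n n"
  shows "is_orthogonal n U" "A = U * mat_diag n (eigval A) * transpose_mat U"
  using assms by (auto simp: is_eigendecomp_def eig_diag_def)

lemma psd_matsD:
  assumes "A \<in> psd_mats n"
  shows "A \<in> carrier_mat n n" "transpose_mat A = A"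
    "v \<in> carrier_vec n \<Longrightarrow> 0 \<le> v \<bullet> (A *\<^sub>v v)"
  using assms by (auto simp: psd_mats_def)

lemma psd_conj:
  assumes A: "A \<in> psd_mats n" and X: "X \<in> carrier_mat m n"
  shows "X * A * transpose_mat X \<in> psd_mats m"
proof -
  note a = psd_matsD[OF A]
  have sym: "transpose_mat (X * A * transpose_mat X) = X * A * transpose_mat X"
    using a(1) X transpose_mult[of "X * A" m n "transpose_mat X" m] transpose_mult[of X m n A n]
    by (simp add: a(2) assoc_mult_mat[of _ m n _ n _ m])
  have "0 \<le> v \<bullet> (X * A * transpose_mat X *\<^sub>v v)" if v: "v \<in> carrier_vec m" for v
  proof -
    let ?w = "transpose_mat X *\<^sub>v v"
    have w: "?w \<in> carrier_vec n" using X v by simp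
    have "X * A * transpose_mat X *\<^sub>v v = X *\<^sub>v (A *\<^sub>v ?w)"
      using X a(1) v w
      by (simp add: assoc_mult_mat_vec[of _ m n _ m] assoc_mult_mat_vec[of _ m n _ n])
    then have "v \<bullet> (X * A * transpose_mat X *\<^sub>v v) = ?w \<bullet> (A *\<^sub>v ?w)"
      using transpose_vec_mult_scalar[OF X _ v, of "A *\<^sub>v ?w"] a(1) w by simp
    with a(3)[OF w] show ?thesis by simp
  qed
  with sym X show ?thesis by (auto simp: psd_mats_def)
qed

lemma one_psd: "1\<^sub>m n \<in> psd_mats n"
proof -
  have "0 \<le> v \<bullet> v" for v :: "real vec" by (simp add: scalar_prod_def sum_nonneg)
  then show ?thesis by (auto simp: psd_mats_def simp del: one_carrier_mat)
qed

lemma psd_gram: "X \<in> carrier_mat m n \<Longrightarrow> X * transpose_mat X \<in> psd_mats m"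
  using psd_conj[OF one_psd, of X m n] by simp

lemma psd_diag_nonneg: "A \<in> psd_mats n \<Longrightarrow> i < n \<Longrightarrow> 0 \<le> A $$ (i, i)"
  using psd_matsD(3)[of A n "unit_vec n i"] psd_matsD(1)[of A n] by auto

lemma psd_mat_diag:
  assumes "\<And>i. i < n \<Longrightarrow> 0 \<le> f i"
  shows "mat_diag n f \<in> psd_mats n"
proof -
  have "mat_diag n (\<lambda>i. sqrt (f i)) * transpose_mat (mat_diag n (\<lambda>i. sqrt (f i))) = mat_diag n f"
    unfolding transpose_mat_diag mat_diag_diag
    using assms by (auto simp: mat_diag_def intro!: eq_matI)
  with psd_gram[of "mat_diag n (\<lambda>i. sqrt (f i))" n n] show ?thesis by simp
qed

lemma diag_of_orthogonal_conj:
  assumes U: "is_orthogonal n U" and D: "D \<in> carrier_mat n n"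
  shows "transpose_mat U * (U * D * transpose_mat U) * U = D"
proof -
  note u = is_orthogonalD[OF U]
  have "transpose_mat U * (U * D * transpose_mat U) * U = (transpose_mat U * U) * D * (transpose_mat U * U)"
    using u(1,2) D by (simp add: assoc_mult_mat[of _ n n _ n _ n] mult_carrier_square)
  then show ?thesis using D by (simp add: u(3))
qed

lemma eigval_psd:
  assumes A: "A \<in> psd_mats n"
  shows "0 \<le> eigval A j" "i \<le> j \<Longrightarrow> eigval A j \<le> eigval A i" "n \<le> j \<Longrightarrow> eigval A j = 0"
proof -
  note a = psd_matsD[OF A]
  have len: "length (eigvals_desc A) = n" by (rule symmetric_eigendecomp(1)[OF a(1,2)])
  obtain U where U: "is_eigendecomp A U" using symmetric_eigendecomp(2)[OF a(1,2)] by blast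
  note u = is_eigendecompD[OF U a(1)]
  have "transpose_mat U * A * transpose_mat (transpose_mat U) \<in> psd_mats n"
    by (rule psd_conj[OF A]) (use is_orthogonalD[OF u(1)] in simp)
  also have "transpose_mat U * A * transpose_mat (transpose_mat U) = mat_diag n (eigval A)"
    using diag_of_orthogonal_conj[OF u(1), of "mat_diag n (eigval A)"] u(2) by simp
  finally have "mat_diag n (eigval A) \<in> psd_mats n" .
  from psd_diag_nonneg[OF this] have "0 \<le> eigval A j" if "j < n" for j
    using that by (auto simp: mat_diag_def)
  then show nonneg: "0 \<le> eigval A j" for j by (cases "j < n") (auto simp: eigval_def len)
  show "n \<le> j \<Longrightarrow> eigval A j = 0" by (simp add: eigval_def len)
  assume ij: "i \<le> j"
  have "sorted_wrt (\<ge>) (eigvals_desc A)"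
    by (simp add: eigvals_desc_def sorted_wrt_rev)
  with ij len nonneg show "eigval A j \<le> eigval A i"
    by (cases "j < n"; cases "i = j") (auto simp: eigval_def sorted_wrt_iff_nth_less)
qed

text \<open>Diagonalise both roots, \<open>B = V D\<^sub>B V\<^sup>T\<close> and \<open>C = W D\<^sub>C W\<^sup>T\<close>, and compare them through the change of
basis \<open>Q = V\<^sup>T W\<close>. Equal squares mean \<open>\<beta>\<^sub>i\<^sup>2 Q\<^sub>i\<^sub>j = Q\<^sub>i\<^sub>j \<gamma>\<^sub>j\<^sup>2\<close> entrywise; as the eigenvalues are
non-negative, the squares can be dropped, which says \<open>D\<^sub>B Q = Q D\<^sub>C\<close> and so \<open>B = C\<close>.\<close>

lemma psd_square_root_unique:
  assumes B: "B \<in> psd_mats n" and C: "C \<in> psd_mats n" and eq: "B * B = C * C"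
  shows "B = C"
proof -
  note b = psd_matsD[OF B] and c = psd_matsD[OF C]
  obtain V where "is_eigendecomp B V" using symmetric_eigendecomp(2)[OF b(1,2)] by blast
  note V = is_eigendecompD[OF this b(1)]
  obtain W where "is_eigendecomp C W" using symmetric_eigendecomp(2)[OF c(1,2)] by blast
  note W = is_eigendecompD[OF this c(1)]
  note v = is_orthogonalD[OF V(1)] and w = is_orthogonalD[OF W(1)]
  note sq = assoc_mult_mat[of _ n n _ n _ n] mult_carrier_square
  define Q where "Q = transpose_mat V * W"
  have Q: "Q \<in> carrier_mat n n" using v w by (simp add: Q_def)
  let ?b = "mat_diag n (eigval B)" and ?c = "mat_diag n (eigval C)"
  have 1: "transpose_mat V * B = ?b * transpose_mat V"
  proof -
    have "transpose_mat V * B = (transpose_mat V * V) * ?b * transpose_mat V"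
      by (subst V(2)) (use v(1,2) in \<open>simp add: sq\<close>)
    then show ?thesis using v(3) by (simp add: left_mult_one_mat[of _ n n])
  qed
  have 2: "C * W = W * ?c"
  proof -
    have "C * W = W * ?c * (transpose_mat W * W)"
      by (subst W(2)) (use w(1,2) in \<open>simp add: sq\<close>)
    then show ?thesis using w(1,3) by (simp add: mult_carrier_square right_mult_one_mat[of _ n n])
  qed
  have "?b * ?b * Q = ?b * (?b * transpose_mat V) * W"
    using v w by (simp add: Q_def sq del: mat_diag_diag)
  also have "\<dots> = ?b * (transpose_mat V * B) * W"
    by (simp only: 1)
  also have "\<dots> = (?b * transpose_mat V) * B * W"
    using v w b(1) by (simp add: sq)
  also have "\<dots> = transpose_mat V * (B * B) * W"
    unfolding 1[symmetric] using v w b(1) by (simp add: sq)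
  also have "\<dots> = transpose_mat V * C * (C * W)"
    using v w c(1) by (simp add: eq sq)
  also have "\<dots> = transpose_mat V * C * (W * ?c)"
    by (simp only: 2)
  also have "\<dots> = transpose_mat V * (C * W) * ?c"
    using v w c(1) by (simp add: sq del: mat_diag_diag)
  also have "\<dots> = Q * (?c * ?c)"
    unfolding 2 using v w by (simp add: sq Q_def del: mat_diag_diag)
  finally have QQ: "mat_diag n (\<lambda>i. eigval B i * eigval B i) * Q = Q * mat_diag n (\<lambda>i. eigval C i * eigval C i)"
    by simp
  have "?b * Q = Q * ?c"
  proof (rule eq_matI)
    fix i j assume "i < dim_row (Q * ?c)" "j < dim_col (Q * ?c)"
    then have ij: "i < n" "j < n" using Q mat_diag_dim[of n "eigval C"] by auto
    have "eigval B i * eigval B i * Q $$ (i, j) = Q $$ (i, j) * (eigval C j * eigval C j)"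
      using arg_cong[OF QQ, of "\<lambda>M. M $$ (i, j)"] ij
      by (simp add: mat_diag_mult_left[OF Q] mat_diag_mult_right[OF Q])
    then have "Q $$ (i, j) = 0 \<or> (eigval B i)\<^sup>2 = (eigval C j)\<^sup>2"
      by (auto simp: power2_eq_square)
    then have "Q $$ (i, j) = 0 \<or> eigval B i = eigval C j"
      using eigval_psd(1)[OF B] eigval_psd(1)[OF C]
      by (auto simp: power2_eq_iff_nonneg)
    then show "(?b * Q) $$ (i, j) = (Q * ?c) $$ (i, j)"
      using ij by (auto simp: mat_diag_mult_left[OF Q] mat_diag_mult_right[OF Q])
  qed (use Q in \<open>auto simp: mat_diag_def\<close>)
  then have "V * (?b * Q) * transpose_mat W = V * (Q * ?c) * transpose_mat W" by simp
  also have "V * (?b * Q) * transpose_mat W = V * ?b * transpose_mat V * (W * transpose_mat W)"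
    using v(1,2) w(1,2) by (simp add: Q_def sq)
  also have "\<dots> = B"
    by (simp only: w(4) V(2)[symmetric] right_mult_one_mat[OF b(1)])
  also have "V * (Q * ?c) * transpose_mat W = (V * transpose_mat V) * (W * ?c * transpose_mat W)"
    using v(1,2) w(1,2) by (simp add: Q_def sq)
  also have "\<dots> = C"
    by (simp only: v(4) W(2)[symmetric] left_mult_one_mat[OF c(1)])
  finally show ?thesis .
qed

lemma mat_sqrt_eqI:
  assumes "B \<in> psd_mats n" "B * B = A"
  shows "mat_sqrt A = B"
proof -
  have "dim_row A = n" using assms psd_matsD(1)[OF assms(1)] by auto
  with assms show ?thesis
    unfolding mat_sqrt_def by (intro the_equality) (auto intro: psd_square_root_unique)
qed

lemma mat_sqrt_diagonalization:
  assumes U: "is_orthogonal n U" and f: "\<And>i. i < n \<Longrightarrow> 0 \<le> f i"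
  shows "mat_sqrt (U * mat_diag n f * transpose_mat U) =
    U * mat_diag n (\<lambda>i. sqrt (f i)) * transpose_mat U"
proof (rule mat_sqrt_eqI)
  note u = is_orthogonalD[OF U]
  let ?s = "mat_diag n (\<lambda>i. sqrt (f i))"
  show "U * ?s * transpose_mat U \<in> psd_mats n"
    by (rule psd_conj[OF psd_mat_diag u(1)]) (use f in simp)
  have "U * ?s * transpose_mat U * (U * ?s * transpose_mat U) =
      U * (?s * (transpose_mat U * U) * ?s) * transpose_mat U"
    by (rule mult_conj_conj[OF u(1,2)]) auto
  also have "\<dots> = U * (?s * ?s) * transpose_mat U"
    unfolding u(3) by (simp add: right_mult_one_mat[of _ n n] del: mat_diag_diag)
  also have "?s * ?s = mat_diag n f"
    unfolding mat_diag_diag using f by (auto simp: mat_diag_def intro!: eq_matI)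
  finally show "U * ?s * transpose_mat U * (U * ?s * transpose_mat U) = U * mat_diag n f * transpose_mat U" .
qed

lemma trace_orthogonal_conj:
  assumes U: "is_orthogonal n U" and D: "D \<in> carrier_mat n n"
  shows "mat_trace (U * D * transpose_mat U) = mat_trace D"
proof -
  note u = is_orthogonalD[OF U]
  have "mat_trace (U * D * transpose_mat U) = mat_trace (transpose_mat U * (U * D))"
    by (rule mat_trace_commute[of _ n n]) (use u D in auto)
  also have "transpose_mat U * (U * D) = (transpose_mat U * U) * D"
    using u(1,2) D by (simp add: assoc_mult_mat[of _ n n _ n _ n])
  finally show ?thesis using u(3) D by simp
qed

lemma mat_sqrt_psd:
  assumes A: "A \<in> psd_mats n"
  shows "mat_sqrt A \<in> psd_mats n" "mat_sqrt A * mat_sqrt A = A"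
    "mat_trace (mat_sqrt A) = (\<Sum>j<n. sqrt (eigval A j))"
    "mat_trace A = (\<Sum>j<n. eigval A j)"
proof -
  note a = psd_matsD[OF A]
  obtain U where "is_eigendecomp A U" using symmetric_eigendecomp(2)[OF a(1,2)] by blast
  note U = is_eigendecompD[OF this a(1)]
  note u = is_orthogonalD[OF U(1)]
  let ?s = "mat_diag n (\<lambda>i. sqrt (eigval A i))"
  have s: "mat_sqrt A = U * ?s * transpose_mat U"
    by (subst U(2), rule mat_sqrt_diagonalization[OF U(1)]) (rule eigval_psd(1)[OF A])
  show "mat_sqrt A \<in> psd_mats n" unfolding s
    by (rule psd_conj[OF psd_mat_diag u(1)]) (use eigval_psd(1)[OF A] in simp)
  have "mat_sqrt A * mat_sqrt A = U * (?s * (transpose_mat U * U) * ?s) * transpose_mat U"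
    unfolding s by (rule mult_conj_conj[OF u(1,2)]) auto
  also have "\<dots> = U * (?s * ?s) * transpose_mat U"
    unfolding u(3) by (simp add: right_mult_one_mat[of _ n n] del: mat_diag_diag)
  also have "?s * ?s = mat_diag n (eigval A)"
    using eigval_psd(1)[OF A] by simp
  finally show "mat_sqrt A * mat_sqrt A = A" using U(2) by simp
  show "mat_trace (mat_sqrt A) = (\<Sum>j<n. sqrt (eigval A j))"
    unfolding s trace_orthogonal_conj[OF U(1) mat_diag_dim] by (rule mat_trace_mat_diag)
  show "mat_trace A = (\<Sum>j<n. eigval A j)"
    by (subst U(2), subst trace_orthogonal_conj[OF U(1) mat_diag_dim]) (rule mat_trace_mat_diag)
qed

text \<open>If the columns of \<open>Y\<close> are orthogonal with squared norms \<open>f j\<close>, then the square root of \<open>Y Y\<^sup>T\<close> is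
\<open>Y diag(f\<^sup>-\<^sup>1\<^sup>/\<^sup>2) Y\<^sup>T\<close>. Columns of norm zero vanish, so reading \<open>1 / 0\<close> as \<open>0\<close> causes no loss.\<close>

lemma trace_sqrt_gram_diag:
  assumes Y: "Y \<in> carrier_mat n m" and f: "transpose_mat Y * Y = mat_diag m f"
  shows "mat_trace (mat_sqrt (Y * transpose_mat Y)) = (\<Sum>j<m. sqrt (f j))"
proof -
  have YT: "transpose_mat Y \<in> carrier_mat m n" using Y by simp
  have col: "f j = (\<Sum>i<n. (Y $$ (i, j))\<^sup>2)" if "j < m" for j
    using arg_cong[OF f, of "\<lambda>M. M $$ (j, j)"] that Y
    unfolding index_mult_mat_sum[OF YT Y that that]
    by (simp add: mat_diag_def power2_eq_square)
  have f0: "0 \<le> f j" if "j < m" for j using col[OF that] by (simp add: sum_nonneg)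
  define g where "g j = 1 / sqrt (f j)" for j
  define N where "N = Y * mat_diag m g * transpose_mat Y"
  have D: "mat_diag m h \<in> carrier_mat m m" for h :: "nat \<Rightarrow> real" by simp
  have "mat_sqrt (Y * transpose_mat Y) = N"
  proof (rule mat_sqrt_eqI)
    show "N \<in> psd_mats n" unfolding N_def
      by (rule psd_conj[OF psd_mat_diag Y]) (use f0 in \<open>auto simp: g_def\<close>)
    have "N * N = Y * (mat_diag m g * (transpose_mat Y * Y) * mat_diag m g) * transpose_mat Y"
      unfolding N_def by (rule mult_conj_conj[OF Y YT D D])
    also have "mat_diag m g * (transpose_mat Y * Y) * mat_diag m g = mat_diag m (\<lambda>i. g i * f i * g i)"
      unfolding f by simp
    also have "Y * mat_diag m (\<lambda>i. g i * f i * g i) = Y"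
    proof (rule eq_matI)
      fix i j assume "i < dim_row Y" "j < dim_col Y"
      then have ij: "i < n" "j < m" using Y by auto
      have "Y $$ (i, j) * (g j * f j * g j) = Y $$ (i, j)"
      proof (cases "f j = 0")
        case True
        then have "(\<Sum>i<n. (Y $$ (i, j))\<^sup>2) = 0" using col[OF ij(2)] by simp
        then have "\<forall>i\<in>{..<n}. (Y $$ (i, j))\<^sup>2 = 0" by (subst (asm) sum_nonneg_eq_0_iff) auto
        with ij show ?thesis by auto
      next
        case False
        then have "g j * f j * g j = 1" using f0[OF ij(2)] by (simp add: g_def field_simps)
        then show ?thesis by simp
      qed
      then show "(Y * mat_diag m (\<lambda>i. g i * f i * g i)) $$ (i, j) = Y $$ (i, j)"
        using ij by (simp add: mat_diag_mult_right[OF Y])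
    qed (use Y in \<open>auto simp: mat_diag_def\<close>)
    finally show "N * N = Y * transpose_mat Y" .
  qed
  moreover have "mat_trace N = mat_trace (transpose_mat Y * (Y * mat_diag m g))"
    unfolding N_def by (rule mat_trace_commute[of _ n m]) (use Y YT D[of g] in auto)
  moreover have "transpose_mat Y * (Y * mat_diag m g) = mat_diag m (\<lambda>i. f i * g i)"
    using assoc_mult_mat[OF YT Y D[of g]] by (simp add: f)
  moreover have "f j * g j = sqrt (f j)" if "j < m" for j
    using f0[OF that] by (simp add: g_def real_div_sqrt)
  ultimately show ?thesis by (simp add: mat_trace_mat_diag)
qed

text \<open>\<open>X X\<^sup>T\<close> and \<open>X\<^sup>T X\<close> have the same non-zero eigenvalues. Rotating \<open>X\<close> by an eigenbasis of \<open>X\<^sup>T X\<close>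
makes its columns orthogonal and leaves \<open>X X\<^sup>T\<close> unchanged.\<close>

lemma trace_sqrt_gram_commute:
  assumes X: "X \<in> carrier_mat n m"
  shows "mat_trace (mat_sqrt (X * transpose_mat X)) = mat_trace (mat_sqrt (transpose_mat X * X))"
proof -
  let ?G = "transpose_mat X * X"
  have XT: "transpose_mat X \<in> carrier_mat m n" using X by simp
  have G: "?G \<in> psd_mats m" using psd_gram[OF XT] by simp
  note g = psd_matsD[OF G]
  obtain V where "is_eigendecomp ?G V" using symmetric_eigendecomp(2)[OF g(1,2)] by blast
  note V = is_eigendecompD[OF this g(1)]
  note v = is_orthogonalD[OF V(1)]
  define Y where "Y = X * V"
  have Y: "Y \<in> carrier_mat n m" using X v by (simp add: Y_def)
  have "transpose_mat Y * Y = transpose_mat V * ?G * V"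
    unfolding Y_def using X XT v(1,2)
    by (simp add: transpose_mult[of _ n m _ m] assoc_mult_mat[of _ m m _ n _ m]
        assoc_mult_mat[of _ m n _ m _ m] assoc_mult_mat[of _ m m _ m _ m])
  also have "\<dots> = mat_diag m (eigval ?G)"
    using diag_of_orthogonal_conj[OF V(1), of "mat_diag m (eigval ?G)"] V(2) by simp
  finally have "mat_trace (mat_sqrt (Y * transpose_mat Y)) = (\<Sum>j<m. sqrt (eigval ?G j))"
    by (rule trace_sqrt_gram_diag[OF Y])
  moreover have "Y * transpose_mat Y = X * (V * transpose_mat V) * transpose_mat X"
    unfolding Y_def using X XT v(1,2)
    by (simp add: transpose_mult[of _ n m _ m] assoc_mult_mat[of _ n m _ m _ n]
        assoc_mult_mat[of _ m m _ m _ n])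
  moreover have "X * (V * transpose_mat V) * transpose_mat X = X * transpose_mat X"
    using X v(4) by simp
  ultimately show ?thesis using mat_sqrt_psd(3)[OF G] by simp
qed

section \<open>Majorisation\<close>

text \<open>Summation by parts: the sum is at most the last weight times the total, which is zero, because each partial sum of
\<open>e\<close> is non-negative and may be given the next, larger weight.\<close>

lemma abel_nonpos:
  fixes s e :: "nat \<Rightarrow> real"
  assumes mono: "\<And>i j. i \<le> j \<Longrightarrow> j < n \<Longrightarrow> s i \<le> s j"
    and partial: "\<And>k. k \<le> n \<Longrightarrow> 0 \<le> (\<Sum>l<k. e l)"
    and total: "(\<Sum>l<n. e l) = 0"
  shows "(\<Sum>l<n. s l * e l) \<le> 0"
proof -
  have bound: "(\<Sum>l<Suc k. s l * e l) \<le> s k * (\<Sum>l<Suc k. e l)" if "Suc k \<le> n" for k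
    using that
  proof (induction k)
    case (Suc k)
    have "(\<Sum>l<Suc (Suc k). s l * e l) \<le> s k * (\<Sum>l<Suc k. e l) + s (Suc k) * e (Suc k)"
      using Suc by simp
    also have "\<dots> \<le> s (Suc k) * (\<Sum>l<Suc k. e l) + s (Suc k) * e (Suc k)"
      using mono[of k "Suc k"] partial[of "Suc k"] Suc.prems
      by (intro add_right_mono mult_right_mono) (auto simp del: sum.lessThan_Suc)
    finally show ?case by (simp add: distrib_left)
  qed simp
  show ?thesis
  proof (cases n)
    case (Suc k)
    with bound[of k] total show ?thesis by simp
  qed simp
qed

text \<open>Karamata's inequality for the square root: a decreasing sequence \<open>c\<close> majorised by \<open>m\<close> has the larger
sum of square roots. The difference \<open>sqrt (m l) - sqrt (c l)\<close> is exactly \<open>(m l - c l) / r l\<close> with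
\<open>r l = sqrt (m l) + sqrt (c l)\<close>. The weights \<open>1 / r l\<close> increase with \<open>l\<close>, so summation by parts
applies.\<close>

lemma sum_sqrt_schur_concave:
  fixes c m :: "nat \<Rightarrow> real"
  assumes c: "\<And>i. 0 \<le> c i" "\<And>i j. i \<le> j \<Longrightarrow> c j \<le> c i"
    and m: "\<And>i. 0 \<le> m i" "\<And>i j. i \<le> j \<Longrightarrow> m j \<le> m i"
    and partial: "\<And>k. k \<le> n \<Longrightarrow> (\<Sum>l<k. c l) \<le> (\<Sum>l<k. m l)"
    and total: "(\<Sum>l<n. c l) = (\<Sum>l<n. m l)"
  shows "(\<Sum>l<n. sqrt (m l)) \<le> (\<Sum>l<n. sqrt (c l))"
proof -
  define r where "r l = sqrt (m l) + sqrt (c l)" for l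
  \<comment> \<open>Where \<open>r\<close> vanishes the difference is \<open>0\<close>, and any weight will do; \<open>K\<close> dominates all the others, so it keeps the weights increasing.\<close>
  define K where "K = (\<Sum>l<n. 1 / r l)"
  define s where "s l = (if r l = 0 then K else 1 / r l)" for l
  have r0: "0 \<le> r l" for l using c(1) m(1) by (simp add: r_def)
  have r_mono: "r j \<le> r i" if "i \<le> j" for i j
    using c(2)[OF that] m(2)[OF that] by (auto simp: r_def intro: add_mono)
  have "s i \<le> s j" if "i \<le> j" "j < n" for i j
  proof (cases "r i = 0 \<or> r j \<noteq> 0")
    case True
    then show ?thesis
      using r_mono[OF that(1)] r0[of i] r0[of j] by (auto simp: s_def intro!: divide_left_mono mult_pos_pos)
  next
    case False
    then have "s i = 1 / r i" "s j = K" by (auto simp: s_def)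
    moreover have "1 / r i \<le> K" unfolding K_def
      using that r0 by (intro member_le_sum[of i "{..<n}" "\<lambda>l. 1 / r l"]) auto
    ultimately show ?thesis by simp
  qed
  moreover have "0 \<le> (\<Sum>l<k. m l - c l)" if "k \<le> n" for k
    using partial[OF that] by (simp add: sum_subtractf)
  ultimately have "(\<Sum>l<n. s l * (m l - c l)) \<le> 0"
    using total by (intro abel_nonpos) (auto simp: sum_subtractf)
  moreover have "s l * (m l - c l) = sqrt (m l) - sqrt (c l)" for l
  proof (cases "r l = 0")
    case True
    then have "sqrt (m l) = 0" "sqrt (c l) = 0"
      using m(1)[of l] c(1)[of l] by (auto simp: r_def add_nonneg_eq_0_iff)
    then show ?thesis by simp
  next
    case False
    have "m l - c l = r l * (sqrt (m l) - sqrt (c l))"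
      using m(1)[of l] c(1)[of l] by (simp add: r_def algebra_simps)
    then show ?thesis using False by (simp add: s_def)
  qed
  ultimately show ?thesis by (simp add: sum_subtractf)
qed

text \<open>Weights in \<open>[0, 1]\<close> of total at most \<open>k\<close> do best when they are all spent on the \<open>k\<close> largest entries:
after subtracting the threshold \<open>a k\<close>, every term is bounded by the positive part of \<open>a i - a k\<close>.\<close>

lemma weighted_sum_le_top_sum:
  fixes a w :: "nat \<Rightarrow> real"
  assumes a: "\<And>i. 0 \<le> a i" "\<And>i j. i \<le> j \<Longrightarrow> a j \<le> a i"
    and w: "\<And>i. i < p \<Longrightarrow> 0 \<le> w i" "\<And>i. i < p \<Longrightarrow> w i \<le> 1"
    and total: "(\<Sum>i<p. w i) \<le> real k"
  shows "(\<Sum>i<p. a i * w i) \<le> (\<Sum>i<k. a i)"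
proof -
  have "(\<Sum>i<p. (a i - a k) * w i) \<le> (\<Sum>i<p. max 0 (a i - a k))"
  proof (rule sum_mono)
    fix i assume i: "i \<in> {..<p}"
    have "(a i - a k) * w i \<le> max 0 (a i - a k) * w i"
      using w(1)[of i] i by (intro mult_right_mono) auto
    also have "\<dots> \<le> max 0 (a i - a k) * 1"
      using w(2)[of i] i by (intro mult_left_mono) auto
    finally show "(a i - a k) * w i \<le> max 0 (a i - a k)" by simp
  qed
  also have "\<dots> \<le> (\<Sum>i<max p k. max 0 (a i - a k))" by (intro sum_mono2) auto
  also have "\<dots> = (\<Sum>i<k. max 0 (a i - a k))"
  proof (rule sum.mono_neutral_right)
    show "\<forall>i\<in>{..<max p k} - {..<k}. max 0 (a i - a k) = 0"
    proof
      fix i assume "i \<in> {..<max p k} - {..<k}"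
      then have "a i - a k \<le> 0" using a(2)[of k i] by simp
      then show "max 0 (a i - a k) = 0" by (rule max_absorb1)
    qed
  qed auto
  also have "\<dots> = (\<Sum>i<k. a i - a k)"
  proof (rule sum.cong[OF refl])
    fix i assume "i \<in> {..<k}"
    then have "0 \<le> a i - a k" using a(2)[of i k] by simp
    then show "max 0 (a i - a k) = a i - a k" by (rule max_absorb2)
  qed
  finally have "(\<Sum>i<p. a i * w i) \<le> (\<Sum>i<k. a i) + a k * ((\<Sum>i<p. w i) - real k)"
    by (simp add: sum_subtractf algebra_simps sum_distrib_left)
  also have "a k * ((\<Sum>i<p. w i) - real k) \<le> 0"
    using a(1)[of k] total by (simp add: mult_nonneg_nonpos)
  finally show ?thesis by simp
qed

lemma sum_swap3: "(\<Sum>m\<in>A. \<Sum>i\<in>B. \<Sum>j\<in>C. f i j m) = (\<Sum>i\<in>B. \<Sum>j\<in>C. \<Sum>m\<in>A. f i j m)"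
proof -
  have "(\<Sum>m\<in>A. \<Sum>i\<in>B. \<Sum>j\<in>C. f i j m) = (\<Sum>i\<in>B. \<Sum>m\<in>A. \<Sum>j\<in>C. f i j m)"
    by (rule sum.swap)
  moreover have "(\<Sum>m\<in>A. \<Sum>j\<in>C. f i j m) = (\<Sum>j\<in>C. \<Sum>m\<in>A. f i j m)" for i
    by (rule sum.swap)
  ultimately show ?thesis by (simp only:)
qed

text \<open>A form of Ky Fan's maximum principle. The rows of \<open>y\<close> are orthogonal with squared norms \<open>a i\<close>; the
left-hand side is the sum of \<open>a i\<close> weighted by the fraction of row \<open>i\<close> that lies in the first \<open>k\<close>
columns. These weights lie in \<open>[0, 1]\<close>, and their total is at most \<open>k\<close> by Bessel's inequality: it is
a sum of \<open>k\<close> diagonal entries of the matrix \<open>P\<close> of the orthogonal projection onto the row space, and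
a symmetric idempotent matrix satisfies \<open>P\<^sub>l\<^sub>l\<^sup>2 \<le> \<Sum>\<^sub>m P\<^sub>l\<^sub>m\<^sup>2 = P\<^sub>l\<^sub>l\<close>.\<close>

lemma orthogonal_rows_column_sum_le:
  fixes y :: "nat \<Rightarrow> nat \<Rightarrow> real"
  assumes gram: "\<And>i j. i < p \<Longrightarrow> j < p \<Longrightarrow> (\<Sum>l<n. y i l * y j l) = (if i = j then a i else 0)"
    and a: "\<And>i. 0 \<le> a i" "\<And>i j. i \<le> j \<Longrightarrow> a j \<le> a i"
    and k: "k \<le> n"
  shows "(\<Sum>l<k. \<Sum>i<p. (y i l)\<^sup>2) \<le> (\<Sum>i<k. a i)"
proof -
  define P where "P l m = (\<Sum>i<p. y i l * y i m / a i)" for l m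
  have zero: "y i l = 0" if "a i = 0" "i < p" "l < n" for i l
  proof -
    have "(\<Sum>l<n. y i l * y i l) = 0" using gram[of i i] that by simp
    then have "\<forall>l\<in>{..<n}. y i l * y i l = 0" by (subst (asm) sum_nonneg_eq_0_iff) auto
    with that show ?thesis by simp
  qed
  have idem: "(\<Sum>m<n. (P l m)\<^sup>2) = P l l" for l
  proof -
    have "(\<Sum>m<n. (P l m)\<^sup>2) = (\<Sum>m<n. \<Sum>i<p. \<Sum>j<p. y i l * y j l / (a i * a j) * (y i m * y j m))"
      unfolding P_def power2_eq_square sum_product by (intro sum.cong) (auto simp: field_simps)
    also have "\<dots> = (\<Sum>i<p. \<Sum>j<p. y i l * y j l / (a i * a j) * (\<Sum>m<n. y i m * y j m))"
      unfolding sum_distrib_left 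
      by (rule sum_swap3[where f = "\<lambda>i j m. y i l * y j l / (a i * a j) * (y i m * y j m)"])
    also have "\<dots> = (\<Sum>i<p. \<Sum>j<p. if j = i then y i l * y j l / (a i * a j) * a i else 0)"
      by (intro sum.cong refl) (auto simp: gram)
    also have "\<dots> = P l l"
      unfolding P_def by (auto intro!: sum.cong)
    finally show ?thesis .
  qed
  have P1: "P l l \<le> 1" if "l < n" for l
  proof -
    have "(P l l)\<^sup>2 \<le> (\<Sum>m<n. (P l m)\<^sup>2)"
      using that by (intro member_le_sum[of l "{..<n}" "\<lambda>m. (P l m)\<^sup>2"]) auto
    then have "P l l * P l l \<le> P l l" unfolding idem by (simp only: power2_eq_square)
    then show ?thesis using mult_le_cancel_left_pos[of "P l l" "P l l" 1] by force
  qed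
  define w where "w i = (\<Sum>l<k. (y i l)\<^sup>2) / a i" for i
  have aw: "a i * w i = (\<Sum>l<k. (y i l)\<^sup>2)" if "i < p" for i
    using zero[OF _ that] k by (auto simp: w_def)
  have "(\<Sum>l<k. \<Sum>i<p. (y i l)\<^sup>2) = (\<Sum>i<p. a i * w i)"
    by (subst sum.swap) (simp add: aw)
  also have "\<dots> \<le> (\<Sum>i<k. a i)"
  proof (rule weighted_sum_le_top_sum[OF a])
    fix i assume i: "i < p"
    show "0 \<le> w i" using a(1)[of i] by (simp add: w_def sum_nonneg)
    have "(\<Sum>l<k. (y i l)\<^sup>2) \<le> (\<Sum>l<n. (y i l)\<^sup>2)" using k by (intro sum_mono2) auto
    also have "\<dots> = a i" using gram[OF i i] by (simp add: power2_eq_square)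
    finally show "w i \<le> 1" using a(1)[of i] by (cases "a i = 0") (auto simp: w_def)
  next
    have "(\<Sum>i<p. w i) = (\<Sum>l<k. P l l)"
      unfolding w_def P_def sum_divide_distrib power2_eq_square by (rule sum.swap)
    also have "\<dots> \<le> (\<Sum>l<k. 1)" using k by (intro sum_mono P1) auto
    finally show "(\<Sum>i<p. w i) \<le> real k" by simp
  qed
  finally show ?thesis .
qed

lemma sum_lessThan_add:
  fixes f :: "nat \<Rightarrow> real"
  shows "(\<Sum>i<p + q. f i) = (\<Sum>i<p. f i) + (\<Sum>i<q. f (p + i))"
  by (induction q) auto

text \<open>The heart of the matter. Let \<open>c\<close> be the eigenvalues of \<open>M\<close> in decreasing order and \<open>U\<close> an
eigenbasis, and put \<open>Y = U diag(sqrt c)\<close>. Then \<open>Y Y\<^sup>T = M\<close>, while the columns of \<open>Y\<close> have squared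
norms \<open>c\<close>. Cut \<open>Y\<close> into its first \<open>p\<close> and last \<open>q\<close> rows. Within each part the rows are orthogonal,
because the diagonal blocks of \<open>M\<close> are diagonal. Ky Fan's principle for both parts gives
\<open>c\<^sub>0 + \<dots> + c\<^sub>k\<^sub>-\<^sub>1 \<le> (a\<^sub>0 + b\<^sub>0) + \<dots> + (a\<^sub>k\<^sub>-\<^sub>1 + b\<^sub>k\<^sub>-\<^sub>1)\<close>, with equality for the full trace. So \<open>c\<close> is
majorised by \<open>a + b\<close>, and Karamata's inequality concludes.\<close>

lemma trace_sqrt_lower_bound:
  assumes M: "M \<in> psd_mats (p + q)"
    and M1: "\<And>i j. i < p \<Longrightarrow> j < p \<Longrightarrow> M $$ (i, j) = (if i = j then a i else 0)"
    and M2: "\<And>i j. i < q \<Longrightarrow> j < q \<Longrightarrow> M $$ (p + i, p + j) = (if i = j then b i else 0)"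
    and a: "\<And>i. 0 \<le> a i" "\<And>i j. i \<le> j \<Longrightarrow> a j \<le> a i" "\<And>i. p \<le> i \<Longrightarrow> a i = 0"
    and b: "\<And>i. 0 \<le> b i" "\<And>i j. i \<le> j \<Longrightarrow> b j \<le> b i" "\<And>i. q \<le> i \<Longrightarrow> b i = 0"
  shows "(\<Sum>j<p + q. sqrt (a j + b j)) \<le> mat_trace (mat_sqrt M)"
proof -
  let ?n = "p + q"
  note m = psd_matsD[OF M]
  obtain U where "is_eigendecomp M U" using symmetric_eigendecomp(2)[OF m(1,2)] by blast
  note U = is_eigendecompD[OF this m(1)]
  note u = is_orthogonalD[OF U(1)]
  let ?c = "eigval M"
  note c = eigval_psd[OF M]
  define y where "y i l = U $$ (i, l) * sqrt (?c l)" for i l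
  have gram: "(\<Sum>l<?n. y i l * y j l) = M $$ (i, j)" if "i < ?n" "j < ?n" for i j
  proof -
    have "M $$ (i, j) = (U * mat_diag ?n ?c * transpose_mat U) $$ (i, j)"
      using U(2) by simp
    also have "\<dots> = (\<Sum>l<?n. (U * mat_diag ?n ?c) $$ (i, l) * transpose_mat U $$ (l, j))"
      by (rule index_mult_mat_sum[OF mult_carrier_mat[OF u(1) mat_diag_dim] u(2) that])
    also have "\<dots> = (\<Sum>l<?n. y i l * y j l)"
      using that u(1) c(1) by (intro sum.cong refl) (auto simp: mat_diag_mult_right[OF u(1)] y_def)
    finally show ?thesis ..
  qed
  have col: "?c l = (\<Sum>i<p. (y i l)\<^sup>2) + (\<Sum>i<q. (y (p + i) l)\<^sup>2)" if "l < ?n" for l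
  proof -
    have "(\<Sum>i<?n. transpose_mat U $$ (l, i) * U $$ (i, l)) = 1"
      unfolding index_mult_mat_sum[OF u(2,1) that that, symmetric] u(3) using that by simp
    then have "(\<Sum>i<?n. U $$ (i, l) * U $$ (i, l)) = 1" using that u(1) by simp
    moreover have "(\<Sum>i<?n. (y i l)\<^sup>2) = (\<Sum>i<?n. U $$ (i, l) * U $$ (i, l)) * ?c l"
      unfolding sum_distrib_right using c(1)
      by (intro sum.cong refl) (simp add: y_def power_mult_distrib, simp add: power2_eq_square)
    ultimately have "(\<Sum>i<?n. (y i l)\<^sup>2) = ?c l" by simp
    then show ?thesis by (simp add: sum_lessThan_add)
  qed
  have "(\<Sum>j<?n. sqrt (a j + b j)) \<le> (\<Sum>j<?n. sqrt (?c j))"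
  proof (rule sum_sqrt_schur_concave[OF c(1,2)])
    fix k assume k: "k \<le> ?n"
    have "(\<Sum>l<k. ?c l) = (\<Sum>l<k. (\<Sum>i<p. (y i l)\<^sup>2) + (\<Sum>i<q. (y (p + i) l)\<^sup>2))"
      using k by (intro sum.cong refl col) simp
    also have "\<dots> = (\<Sum>l<k. \<Sum>i<p. (y i l)\<^sup>2) + (\<Sum>l<k. \<Sum>i<q. (y (p + i) l)\<^sup>2)"
      by (rule sum.distrib)
    also have "\<dots> \<le> (\<Sum>l<k. a l) + (\<Sum>l<k. b l)"
      by (intro add_mono orthogonal_rows_column_sum_le[OF _ a(1,2) k]
          orthogonal_rows_column_sum_le[OF _ b(1,2) k]) (simp_all add: gram M1 M2)
    finally show "(\<Sum>l<k. ?c l) \<le> (\<Sum>l<k. a l + b l)" by (simp add: sum.distrib)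
  next
    have "(\<Sum>l<?n. ?c l) = (\<Sum>i<?n. M $$ (i, i))"
      using mat_sqrt_psd(4)[OF M] mat_trace_sum[OF m(1)] by simp
    also have "\<dots> = (\<Sum>i<p. a i) + (\<Sum>i<q. b i)"
      by (simp add: sum_lessThan_add M1 M2)
    also have "(\<Sum>i<p. a i) = (\<Sum>i<?n. a i)" using a(3) by (intro sum.mono_neutral_left) auto
    also have "(\<Sum>i<q. b i) = (\<Sum>i<?n. b i)" using b(3) by (intro sum.mono_neutral_left) auto
    finally show "(\<Sum>l<?n. ?c l) = (\<Sum>l<?n. a l + b l)" by (simp add: sum.distrib)
  qed (use a b in \<open>auto intro: add_mono\<close>)
  then show ?thesis by (simp add: mat_sqrt_psd(3)[OF M])
qed

section \<open>Distances and block matrices\<close>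

lemma trace_sqrt_orthogonal_conj:
  assumes U: "is_orthogonal n U" and M: "M \<in> psd_mats n"
  shows "mat_trace (mat_sqrt (U * M * transpose_mat U)) = mat_trace (mat_sqrt M)"
proof -
  note u = is_orthogonalD[OF U] and r = psd_matsD[OF mat_sqrt_psd(1)[OF M]]
  have "mat_sqrt (U * M * transpose_mat U) = U * mat_sqrt M * transpose_mat U"
  proof (rule mat_sqrt_eqI)
    show "U * mat_sqrt M * transpose_mat U \<in> psd_mats n"
      by (rule psd_conj[OF mat_sqrt_psd(1)[OF M] u(1)])
    show "U * mat_sqrt M * transpose_mat U * (U * mat_sqrt M * transpose_mat U) = U * M * transpose_mat U"
      unfolding mult_conj_conj[OF u(1,2) r(1) r(1)] u(3) right_mult_one_mat[OF r(1)]
        mat_sqrt_psd(2)[OF M] ..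
  qed
  then show ?thesis using trace_orthogonal_conj[OF U r(1)] by simp
qed

text \<open>With \<open>X = A\<^sup>1\<^sup>/\<^sup>2 B\<^sup>1\<^sup>/\<^sup>2\<close> the two matrices under the outer root are \<open>X X\<^sup>T\<close> and \<open>X\<^sup>T X\<close>. Hence the
Bures--Wasserstein distance is symmetric in its arguments.\<close>

lemma trace_sqrt_fidelity_commute:
  assumes A: "A \<in> psd_mats n" and B: "B \<in> psd_mats n"
  shows "mat_trace (mat_sqrt (mat_sqrt A * B * mat_sqrt A)) =
    mat_trace (mat_sqrt (mat_sqrt B * A * mat_sqrt B))"
proof -
  note a = psd_matsD[OF mat_sqrt_psd(1)[OF A]] and b = psd_matsD[OF mat_sqrt_psd(1)[OF B]]
  let ?X = "mat_sqrt A * mat_sqrt B"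
  have X: "?X \<in> carrier_mat n n" and XT: "transpose_mat ?X = mat_sqrt B * mat_sqrt A"
    using a(1) b(1) by (simp_all add: transpose_mult[of _ n n _ n] a(2) b(2))
  have "?X * transpose_mat ?X = mat_sqrt A * (mat_sqrt B * mat_sqrt B) * mat_sqrt A"
    unfolding XT using a(1) b(1) by (simp add: assoc_mult_mat[of _ n n _ n _ n] mult_carrier_square)
  moreover have "transpose_mat ?X * ?X = mat_sqrt B * (mat_sqrt A * mat_sqrt A) * mat_sqrt B"
    unfolding XT using a(1) b(1) by (simp add: assoc_mult_mat[of _ n n _ n _ n] mult_carrier_square)
  ultimately show ?thesis
    using trace_sqrt_gram_commute[OF X] by (simp add: mat_sqrt_psd(2)[OF A] mat_sqrt_psd(2)[OF B])
qed

lemma bw_dist2_one: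
  assumes T: "T \<in> psd_mats n"
  shows "bw_dist2 T (1\<^sub>m n) = mat_trace T + real n - 2 * mat_trace (mat_sqrt T)"
proof -
  note r = psd_matsD[OF mat_sqrt_psd(1)[OF T]]
  have "mat_sqrt T * 1\<^sub>m n * mat_sqrt T = T"
    unfolding right_mult_one_mat[OF r(1)] by (rule mat_sqrt_psd(2)[OF T])
  then show ?thesis by (simp add: bw_dist2_def mat_trace_def[of "1\<^sub>m n"])
qed

lemma four_block_conj:
  fixes U :: "'a :: comm_ring_1 mat"
  assumes U: "U \<in> carrier_mat p p" and V: "V \<in> carrier_mat q q"
    and A: "A \<in> carrier_mat p p" and B: "B \<in> carrier_mat p q"
    and C: "C \<in> carrier_mat q p" and D: "D \<in> carrier_mat q q"
  shows "four_block_mat U (0\<^sub>m p q) (0\<^sub>m q p) V * four_block_mat A B C D *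
      transpose_mat (four_block_mat U (0\<^sub>m p q) (0\<^sub>m q p) V) =
    four_block_mat (U * A * transpose_mat U) (U * B * transpose_mat V)
      (V * C * transpose_mat U) (V * D * transpose_mat V)"
proof -
  have UT: "transpose_mat U \<in> carrier_mat p p" and VT: "transpose_mat V \<in> carrier_mat q q"
    using U V by simp_all
  have T: "transpose_mat (four_block_mat U (0\<^sub>m p q) (0\<^sub>m q p) V) =
      four_block_mat (transpose_mat U) (0\<^sub>m p q) (0\<^sub>m q p) (transpose_mat V)"
    using transpose_four_block_mat[OF U zero_carrier_mat zero_carrier_mat V] by simp
  have L: "four_block_mat U (0\<^sub>m p q) (0\<^sub>m q p) V * four_block_mat A B C D =
      four_block_mat (U * A) (U * B) (V * C) (V * D)"
    using mult_four_block_mat[OF U zero_carrier_mat zero_carrier_mat V A B C D] U V A B C D by simp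
  have c: "U * A \<in> carrier_mat p p" "U * B \<in> carrier_mat p q" "V * C \<in> carrier_mat q p" "V * D \<in> carrier_mat q q"
    using U V A B C D by simp_all
  show ?thesis
    by (simp only: L T mult_four_block_mat[OF c UT zero_carrier_mat zero_carrier_mat VT]
        right_mult_zero_mat[OF c(1)] right_mult_zero_mat[OF c(2)]
        right_mult_zero_mat[OF c(3)] right_mult_zero_mat[OF c(4)]
        right_add_zero_mat[OF mult_carrier_mat[OF c(1) UT]] left_add_zero_mat[OF mult_carrier_mat[OF c(2) VT]]
        right_add_zero_mat[OF mult_carrier_mat[OF c(3) UT]] left_add_zero_mat[OF mult_carrier_mat[OF c(4) VT]])
qed

lemma mat_diag_split:
  "mat_diag (p + q) (\<lambda>i. if i < p then f i else g (i - p)) =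
    four_block_mat (mat_diag p f) (0\<^sub>m p q) (0\<^sub>m q p) (mat_diag q g)"
  by (rule eq_matI) (auto simp: mat_diag_def)

text \<open>The block column formed by \<open>diag(f)\<close> on top of \<open>diag(g)\<close>, extended by zero columns to a square
matrix so that the same dimension serves all factors. Its column \<open>j\<close> is \<open>f j\<close> times the \<open>j\<close>-th unit
vector of the first block (for \<open>j < p\<close>) plus \<open>g j\<close> times that of the second (for \<open>j < q\<close>), so its
columns are orthogonal.\<close>

definition stacked_diag :: "nat \<Rightarrow> nat \<Rightarrow> (nat \<Rightarrow> real) \<Rightarrow> (nat \<Rightarrow> real) \<Rightarrow> real mat" where
  "stacked_diag p q f g = mat (p + q) (p + q)
     (\<lambda>(i, j). if i < p then (if j = i then f i else 0) else (if j = i - p then g (i - p) else 0))"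

lemma stacked_diag_carrier [simp]: "stacked_diag p q f g \<in> carrier_mat (p + q) (p + q)"
  by (simp add: stacked_diag_def)

text \<open>Column \<open>j\<close> meets the first block only if \<open>j < p\<close> and the second only if \<open>j < q\<close>; the hypotheses let
the formula for its squared norm hold for all columns.\<close>

lemma stacked_diag_gram:
  assumes f: "\<And>i. p \<le> i \<Longrightarrow> f i = 0" and g: "\<And>i. q \<le> i \<Longrightarrow> g i = 0"
  shows "transpose_mat (stacked_diag p q f g) * stacked_diag p q f g =
    mat_diag (p + q) (\<lambda>j. (f j)\<^sup>2 + (g j)\<^sup>2)"
proof (rule eq_matI)
  let ?W = "stacked_diag p q f g"
  fix j k assume "j < dim_row (mat_diag (p + q) (\<lambda>j. (f j)\<^sup>2 + (g j)\<^sup>2))"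
    "k < dim_col (mat_diag (p + q) (\<lambda>j. (f j)\<^sup>2 + (g j)\<^sup>2))"
  then have jk: "j < p + q" "k < p + q" by (simp_all add: mat_diag_def)
  have "(transpose_mat ?W * ?W) $$ (j, k) = (\<Sum>i<p + q. transpose_mat ?W $$ (j, i) * ?W $$ (i, k))"
    by (rule index_mult_mat_sum[of _ _ "p + q"]) (use jk in auto)
  also have "\<dots> = (\<Sum>i<p. transpose_mat ?W $$ (j, i) * ?W $$ (i, k)) +
      (\<Sum>i<q. transpose_mat ?W $$ (j, p + i) * ?W $$ (p + i, k))"
    by (rule sum_lessThan_add)
  also have "(\<Sum>i<p. transpose_mat ?W $$ (j, i) * ?W $$ (i, k)) =
      (\<Sum>i<p. if i = j then (if j = k then (f j)\<^sup>2 else 0) else 0)"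
    using jk by (intro sum.cong refl) (auto simp: stacked_diag_def power2_eq_square)
  also have "\<dots> = (if j = k then (f j)\<^sup>2 else 0)"
    by (cases "j < p") (simp_all add: f)
  also have "(\<Sum>i<q. transpose_mat ?W $$ (j, p + i) * ?W $$ (p + i, k)) =
      (\<Sum>i<q. if i = j then (if j = k then (g j)\<^sup>2 else 0) else 0)"
    using jk by (intro sum.cong refl) (auto simp: stacked_diag_def power2_eq_square)
  also have "\<dots> = (if j = k then (g j)\<^sup>2 else 0)"
    by (cases "j < q") (simp_all add: g)
  finally show "(transpose_mat ?W * ?W) $$ (j, k) = mat_diag (p + q) (\<lambda>j. (f j)\<^sup>2 + (g j)\<^sup>2) $$ (j, k)"
    using jk by (simp add: mat_diag_def)
qed (simp_all add: stacked_diag_def mat_diag_def)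

text \<open>With square roots of eigenvalues for \<open>f\<close> and \<open>g\<close>, this is the extremal coupling \<open>\<Sigma>\<^sub>m\<close> written
in the eigenbases of the marginals.\<close>

lemma stacked_diag_outer:
  "stacked_diag p q f g * transpose_mat (stacked_diag p q f g) =
    four_block_mat (mat_diag p (\<lambda>i. (f i)\<^sup>2)) (mat_diag p f * Pi_mat p q * mat_diag q g)
      (transpose_mat (mat_diag p f * Pi_mat p q * mat_diag q g)) (mat_diag q (\<lambda>i. (g i)\<^sup>2))"
    (is "_ = ?F")
proof (rule eq_matI)
  let ?W = "stacked_diag p q f g"
  have Pi: "Pi_mat p q \<in> carrier_mat p q" by (simp add: Pi_mat_def)
  have P: "mat_diag p f * Pi_mat p q * mat_diag q g = mat p q (\<lambda>(i, j). if i = j then f i * g j else 0)"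
    unfolding mat_diag_mult_left[OF Pi] by (subst mat_diag_mult_right[of _ p]) (auto simp: Pi_mat_def)
  {
    fix i k assume "i < dim_row ?F" "k < dim_col ?F"
    then have ik: "i < p + q" "k < p + q" by (simp_all add: mat_diag_def)
    have "(?W * transpose_mat ?W) $$ (i, k) = (\<Sum>j<p + q. ?W $$ (i, j) * transpose_mat ?W $$ (j, k))"
      by (rule index_mult_mat_sum[of _ "p + q"]) (use ik in auto)
    also have "\<dots> = (\<Sum>j<p + q. if j = (if i < p then i else i - p) then
        (if i < p then f i else g (i - p)) *
        (if (if k < p then k else k - p) = (if i < p then i else i - p) then (if k < p then f k else g (k - p)) else 0) else 0)"
      using ik by (intro sum.cong refl) (auto simp: stacked_diag_def)
    also have "\<dots> = (if i < p then f i else g (i - p)) *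
        (if (if k < p then k else k - p) = (if i < p then i else i - p) then (if k < p then f k else g (k - p)) else 0)"
      using ik by (subst sum.delta) auto
    also have "\<dots> = ?F $$ (i, k)"
      using ik unfolding P by (auto simp: mat_diag_def power2_eq_square)
    finally show "(?W * transpose_mat ?W) $$ (i, k) = ?F $$ (i, k)" .
  }
qed (simp_all add: stacked_diag_def mat_diag_def)

lemma sqrt_add_less:
  assumes "0 < x" "0 < (y::real)"
  shows "sqrt (x + y) < sqrt x + sqrt y"
proof (rule real_less_lsqrt)
  have "0 < 2 * (sqrt x * sqrt y)" using assms by simp
  then show "x + y < (sqrt x + sqrt y)\<^sup>2" using assms by (simp add: power2_sum)
qed (use assms in simp)

lemma sum_sqrt_add_less:
  fixes a b :: "nat \<Rightarrow> real"
  assumes "\<And>i. 0 \<le> a i" "\<And>i. 0 \<le> b i" and "0 < a 0" "0 < b 0" "0 < n"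
  shows "(\<Sum>j<n. sqrt (a j + b j)) < (\<Sum>j<n. sqrt (a j) + sqrt (b j))"
  by (rule sum_strict_mono_ex1) (use assms sqrt_add_less[of "a 0" "b 0"] in \<open>auto intro!: sqrt_add_le_add_sqrt\<close>)

section \<open>Couplings of two marginals with given eigenbases\<close>

locale eigendecomposed_marginals =
  fixes p q :: nat and S1 S2 U1 U2 :: "real mat"
  assumes S1: "S1 \<in> psd_mats p" and S2: "S2 \<in> psd_mats q"
    and eig1: "is_eigendecomp S1 U1" and eig2: "is_eigendecomp S2 U2"
begin

abbreviation "a \<equiv> eigval S1"
abbreviation "b \<equiv> eigval S2"

definition U :: "real mat" where
  "U = four_block_mat U1 (0\<^sub>m p q) (0\<^sub>m q p) U2"

text \<open>The square root of the block-diagonal \<open>\<Sigma>\<^sub>0\<close> in the eigenbasis \<open>U\<close>.\<close>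

definition zero_root :: "real mat" where
  "zero_root = mat_diag (p + q) (\<lambda>i. if i < p then sqrt (a i) else sqrt (b (i - p)))"

lemmas s1 = psd_matsD[OF S1]
lemmas s2 = psd_matsD[OF S2]
lemmas a = eigval_psd[OF S1]
lemmas b = eigval_psd[OF S2]
lemmas diag1 = is_eigendecompD[OF eig1 s1(1)]
lemmas diag2 = is_eigendecompD[OF eig2 s2(1)]
lemmas u1 = is_orthogonalD[OF diag1(1)]
lemmas u2 = is_orthogonalD[OF diag2(1)]

lemma dims [simp]: "dim_row S1 = p" "dim_row S2 = q" "dim_col S1 = p" "dim_col S2 = q"
  using s1(1) s2(1) by auto

lemma U_orthogonal: "is_orthogonal (p + q) U"
proof -
  have "transpose_mat U = four_block_mat (transpose_mat U1) (0\<^sub>m p q) (0\<^sub>m q p) (transpose_mat U2)"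
    using transpose_four_block_mat[OF u1(1) zero_carrier_mat zero_carrier_mat u2(1)] by (simp add: U_def)
  then have "transpose_mat U * U = four_block_mat (1\<^sub>m p) (0\<^sub>m p q) (0\<^sub>m q p) (1\<^sub>m q)"
    using block_diag_mult[OF u1(2) u2(2) u1(1) u2(1)] by (simp add: U_def u1(3) u2(3))
  then show ?thesis using u1(1) u2(1) by (simp add: is_orthogonal_def U_def)
qed

lemmas u = is_orthogonalD[OF U_orthogonal]

lemma zero_root_carrier: "zero_root \<in> carrier_mat (p + q) (p + q)"
  by (simp add: zero_root_def)

text \<open>Passing to the eigenbases of the two marginals makes the diagonal blocks diagonal, which is the
situation of \<open>trace_sqrt_lower_bound\<close>.\<close>

lemma Gamma_rotated:
  assumes "T \<in> Gamma_set S1 S2"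
  shows "\<exists>M. M \<in> psd_mats (p + q) \<and> T = U * M * transpose_mat U \<and>
    (\<forall>i<p. \<forall>j<p. M $$ (i, j) = (if i = j then a i else 0)) \<and>
    (\<forall>i<q. \<forall>j<q. M $$ (p + i, p + j) = (if i = j then b i else 0))"
proof -
  from assms obtain B C where T: "T \<in> psd_mats (p + q)" and B: "B \<in> carrier_mat p q"
    and C: "C \<in> carrier_mat q p" and TB: "T = four_block_mat S1 B C S2"
    by (auto simp: Gamma_set_def)
  define M where "M = four_block_mat (mat_diag p a) (transpose_mat U1 * B * U2)
    (transpose_mat U2 * C * U1) (mat_diag q b)"
  have B': "transpose_mat U1 * B * U2 \<in> carrier_mat p q" and C': "transpose_mat U2 * C * U1 \<in> carrier_mat q p"
    using u1(1,2) u2(1,2) B C by simp_all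
  have M: "M \<in> carrier_mat (p + q) (p + q)"
    unfolding M_def by (rule four_block_carrier_mat) simp_all
  have "U1 * (transpose_mat U1 * B * U2) * transpose_mat U2 = (U1 * transpose_mat U1) * B * (U2 * transpose_mat U2)"
    using u1(1,2) u2(1,2) B B'
    by (simp add: assoc_mult_mat[of _ p p _ p _ q] assoc_mult_mat[of _ p p _ q _ q]
        assoc_mult_mat[of _ p q _ q _ q])
  then have BB: "U1 * (transpose_mat U1 * B * U2) * transpose_mat U2 = B"
    by (simp only: u1(4) u2(4) left_mult_one_mat[OF B] right_mult_one_mat[OF B])
  have "U2 * (transpose_mat U2 * C * U1) * transpose_mat U1 = (U2 * transpose_mat U2) * C * (U1 * transpose_mat U1)"
    using u1(1,2) u2(1,2) C C'
    by (simp add: assoc_mult_mat[of _ q q _ q _ p] assoc_mult_mat[of _ q q _ p _ p]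
        assoc_mult_mat[of _ q p _ p _ p])
  then have CC: "U2 * (transpose_mat U2 * C * U1) * transpose_mat U1 = C"
    by (simp only: u1(4) u2(4) left_mult_one_mat[OF C] right_mult_one_mat[OF C])
  have TM: "T = U * M * transpose_mat U"
    unfolding TB U_def M_def four_block_conj[OF u1(1) u2(1) mat_diag_dim B' C' mat_diag_dim] BB CC
    using diag1(2) diag2(2) by simp
  have "transpose_mat U * T * transpose_mat (transpose_mat U) \<in> psd_mats (p + q)"
    by (rule psd_conj[OF T u(2)])
  also have "transpose_mat U * T * transpose_mat (transpose_mat U) = M"
    using diag_of_orthogonal_conj[OF U_orthogonal M] TM by simp
  finally have "M \<in> psd_mats (p + q)" .
  with TM show ?thesis by (intro exI[of _ M]) (auto simp: M_def mat_diag_def)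
qed

lemma trace_sqrt_ge:
  assumes "T \<in> Gamma_set S1 S2"
  shows "(\<Sum>j<p + q. sqrt (a j + b j)) \<le> mat_trace (mat_sqrt T)"
proof -
  from Gamma_rotated[OF assms] obtain M where M: "M \<in> psd_mats (p + q)" "T = U * M * transpose_mat U"
    "\<And>i j. i < p \<Longrightarrow> j < p \<Longrightarrow> M $$ (i, j) = (if i = j then a i else 0)"
    "\<And>i j. i < q \<Longrightarrow> j < q \<Longrightarrow> M $$ (p + i, p + j) = (if i = j then b i else 0)" by blast
  show ?thesis
    unfolding M(2) trace_sqrt_orthogonal_conj[OF U_orthogonal M(1)]
    by (rule trace_sqrt_lower_bound[OF M(1,3,4) a b])
qed

lemma Sigma_zero_diag:
  "Sigma_zero S1 S2 = U * mat_diag (p + q) (\<lambda>i. if i < p then a i else b (i - p)) * transpose_mat U"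
proof -
  have z: "U1 * 0\<^sub>m p q * transpose_mat U2 = 0\<^sub>m p q" "U2 * 0\<^sub>m q p * transpose_mat U1 = 0\<^sub>m q p"
    using u1(1,2) u2(1,2) by simp_all
  show ?thesis
    unfolding mat_diag_split U_def
      four_block_conj[OF u1(1) u2(1) mat_diag_dim zero_carrier_mat zero_carrier_mat mat_diag_dim] z
      diag1(2)[symmetric] diag2(2)[symmetric]
    by (simp add: Sigma_zero_def)
qed

lemma sqrt_Sigma_zero: "mat_sqrt (Sigma_zero S1 S2) = U * zero_root * transpose_mat U"
proof -
  have "(\<lambda>i. sqrt (if i < p then a i else b (i - p))) = (\<lambda>i. if i < p then sqrt (a i) else sqrt (b (i - p)))"
    by auto
  then show ?thesis
    unfolding Sigma_zero_diag zero_root_def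
    using mat_sqrt_diagonalization[OF U_orthogonal, of "\<lambda>i. if i < p then a i else b (i - p)"] a(1) b(1)
    by simp
qed

lemma Sigma_zero_psd: "Sigma_zero S1 S2 \<in> psd_mats (p + q)"
  unfolding Sigma_zero_diag by (rule psd_conj[OF psd_mat_diag u(1)]) (use a(1) b(1) in auto)

lemma sqrt_Sigma_zero_conj:
  assumes M: "M \<in> carrier_mat (p + q) (p + q)"
  shows "mat_sqrt (Sigma_zero S1 S2) * (U * M * transpose_mat U) * mat_sqrt (Sigma_zero S1 S2) =
    U * (zero_root * M * zero_root) * transpose_mat U"
proof -
  note c = zero_root_carrier
  have "mat_sqrt (Sigma_zero S1 S2) * (U * M * transpose_mat U) = U * (zero_root * M) * transpose_mat U"
    unfolding sqrt_Sigma_zero mult_conj_conj[OF u(1,2) c M] u(3) right_mult_one_mat[OF c] ..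
  then show ?thesis
    unfolding sqrt_Sigma_zero
    using mult_conj_conj[OF u(1,2) mult_carrier_mat[OF c M] c]
    by (simp only: u(3) right_mult_one_mat[OF mult_carrier_mat[OF c M]])
qed

text \<open>This reduces to the same bound: the diagonal blocks of \<open>\<Sigma>\<^sub>0\<^sup>1\<^sup>/\<^sup>2 T \<Sigma>\<^sub>0\<^sup>1\<^sup>/\<^sup>2\<close> are
\<open>\<Sigma>\<^sub>j\<^sup>1\<^sup>/\<^sup>2 \<Sigma>\<^sub>j \<Sigma>\<^sub>j\<^sup>1\<^sup>/\<^sup>2 = \<Sigma>\<^sub>j\<^sup>2\<close>, so the eigenvalues of the marginals are simply squared.\<close>

lemma trace_sqrt_fidelity_ge:
  assumes "T \<in> Gamma_set S1 S2"
  shows "(\<Sum>j<p + q. sqrt ((a j)\<^sup>2 + (b j)\<^sup>2)) \<le>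
    mat_trace (mat_sqrt (mat_sqrt (Sigma_zero S1 S2) * T * mat_sqrt (Sigma_zero S1 S2)))"
proof -
  from Gamma_rotated[OF assms] obtain M where M: "M \<in> psd_mats (p + q)" "T = U * M * transpose_mat U"
    "\<And>i j. i < p \<Longrightarrow> j < p \<Longrightarrow> M $$ (i, j) = (if i = j then a i else 0)"
    "\<And>i j. i < q \<Longrightarrow> j < q \<Longrightarrow> M $$ (p + i, p + j) = (if i = j then b i else 0)" by blast
  note m = psd_matsD[OF M(1)]
  let ?K = "zero_root * M * zero_root"
  have "zero_root * M * transpose_mat zero_root \<in> psd_mats (p + q)" by (rule psd_conj[OF M(1) zero_root_carrier])
  then have K: "?K \<in> psd_mats (p + q)" by (simp add: zero_root_def)
  have entry: "?K $$ (i, j) = (if i < p then sqrt (a i) else sqrt (b (i - p))) * M $$ (i, j) *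
      (if j < p then sqrt (a j) else sqrt (b (j - p)))" if "i < p + q" "j < p + q" for i j
    unfolding zero_root_def mat_diag_mult_left[OF m(1)] using that
    by (subst mat_diag_mult_right[of _ "p + q"]) auto
  have "(\<Sum>j<p + q. sqrt ((a j)\<^sup>2 + (b j)\<^sup>2)) \<le> mat_trace (mat_sqrt ?K)"
  proof (rule trace_sqrt_lower_bound[OF K])
    show "?K $$ (i, j) = (if i = j then (a i)\<^sup>2 else 0)" if "i < p" "j < p" for i j
    proof -
      have "?K $$ (i, j) = sqrt (a i) * (if i = j then a i else 0) * sqrt (a j)"
        using that by (simp add: entry M(3))
      then show ?thesis using a(1)[of j] by (simp add: power2_eq_square mult.assoc mult.left_commute[of _ "a i"])
    qed
    show "?K $$ (p + i, p + j) = (if i = j then (b i)\<^sup>2 else 0)" if "i < q" "j < q" for i j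
    proof -
      have "?K $$ (p + i, p + j) = sqrt (b i) * (if i = j then b i else 0) * sqrt (b j)"
        using that by (simp add: entry M(4))
      then show ?thesis using b(1)[of j] by (simp add: power2_eq_square mult.assoc mult.left_commute[of _ "b i"])
    qed
  qed (use a b in \<open>auto intro: power_mono\<close>)
  then show ?thesis
    unfolding M(2) sqrt_Sigma_zero_conj[OF m(1)] trace_sqrt_orthogonal_conj[OF U_orthogonal K] .
qed

abbreviation "W \<equiv> stacked_diag p q (\<lambda>i. sqrt (a i)) (\<lambda>i. sqrt (b i))"

lemma Sigma_m_factor: "Sigma_m U1 U2 S1 S2 = U * (W * transpose_mat W) * transpose_mat U"
proof -
  let ?P = "mat_diag p (\<lambda>i. sqrt (a i)) * Pi_mat p q * mat_diag q (\<lambda>i. sqrt (b i))"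
  have Pi: "Pi_mat p q \<in> carrier_mat p q" by (simp add: Pi_mat_def)
  have sqrt_diag: "mat_sqrt (mat_diag n f) = mat_diag n (\<lambda>i. sqrt (f i))" if "\<And>i. 0 \<le> f i" for n f
    by (rule mat_sqrt_eqI[OF psd_mat_diag]) (use that in auto)
  have da: "mat_diag p (\<lambda>i. sqrt (a i)) \<in> carrier_mat p p" and db: "mat_diag q (\<lambda>i. sqrt (b i)) \<in> carrier_mat q q"
    by simp_all
  have P: "?P \<in> carrier_mat p q" by (rule mult_carrier_mat[OF mult_carrier_mat[OF da Pi] db])
  have PT: "transpose_mat ?P \<in> carrier_mat q p" using P by simp
  have Psi: "Psi_m U1 U2 S1 S2 = U1 * ?P * transpose_mat U2"
  proof -
    have "Psi_m U1 U2 S1 S2 = U1 * mat_diag p (\<lambda>i. sqrt (a i)) * Pi_mat p q * mat_diag q (\<lambda>i. sqrt (b i)) * transpose_mat U2"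
      by (simp add: Psi_m_def eig_diag_def sqrt_diag a(1) b(1))
    also have "U1 * mat_diag p (\<lambda>i. sqrt (a i)) * Pi_mat p q * mat_diag q (\<lambda>i. sqrt (b i)) = U1 * ?P"
      by (simp only: assoc_mult_mat[OF u1(1) da Pi] assoc_mult_mat[OF u1(1) mult_carrier_mat[OF da Pi] db])
    finally show ?thesis .
  qed
  have PsiT: "transpose_mat (Psi_m U1 U2 S1 S2) = U2 * transpose_mat ?P * transpose_mat U1"
    unfolding Psi
      transpose_mult[OF mult_carrier_mat[OF u1(1) P] u2(2)] transpose_mult[OF u1(1) P] transpose_transpose
      assoc_mult_mat[OF u2(1) PT u1(2)] ..
  have "U * (W * transpose_mat W) * transpose_mat U =
      four_block_mat (U1 * mat_diag p a * transpose_mat U1) (U1 * ?P * transpose_mat U2)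
        (U2 * transpose_mat ?P * transpose_mat U1) (U2 * mat_diag q b * transpose_mat U2)"
    unfolding stacked_diag_outer U_def
    using four_block_conj[OF u1(1) u2(1) mat_diag_dim P PT mat_diag_dim, of a b]
    by (simp add: real_sqrt_pow2 a(1) b(1))
  then show ?thesis
    unfolding Sigma_m_def PsiT unfolding Psi diag1(2)[symmetric] diag2(2)[symmetric] by simp
qed

lemma gram_orthogonal:
  assumes X: "X \<in> carrier_mat (p + q) (p + q)"
  shows "(U * X) * transpose_mat (U * X) = U * (X * transpose_mat X) * transpose_mat U"
    "transpose_mat (U * X) * (U * X) = transpose_mat X * X"
proof -
  have XT: "transpose_mat X \<in> carrier_mat (p + q) (p + q)" using X by simp
  note sq = assoc_mult_mat[of _ "p + q" "p + q" _ "p + q" _ "p + q"] mult_carrier_square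
  note t = transpose_mult[OF u(1) X]
  show "(U * X) * transpose_mat (U * X) = U * (X * transpose_mat X) * transpose_mat U"
    unfolding t using u(1,2) X XT by (simp add: sq)
  have "transpose_mat (U * X) * (U * X) = transpose_mat X * (transpose_mat U * U) * X"
    unfolding t using u(1,2) X XT by (simp add: sq)
  then show "transpose_mat (U * X) * (U * X) = transpose_mat X * X"
    by (simp only: u(3) right_mult_one_mat[OF XT])
qed

lemma Sigma_m_Gamma: "Sigma_m U1 U2 S1 S2 \<in> Gamma_set S1 S2"
proof -
  have "Sigma_m U1 U2 S1 S2 \<in> psd_mats (p + q)"
    unfolding Sigma_m_factor by (rule psd_conj[OF psd_gram[OF stacked_diag_carrier] u(1)])
  moreover have "Psi_m U1 U2 S1 S2 \<in> carrier_mat p q"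
    by (rule carrier_matI) (use u1(1) u2(1) in \<open>simp_all add: Psi_m_def\<close>)
  ultimately show ?thesis
    unfolding Gamma_set_def dims Sigma_m_def
    by (intro CollectI conjI bexI[of _ "Psi_m U1 U2 S1 S2"] bexI[of _ "transpose_mat (Psi_m U1 U2 S1 S2)"]) auto
qed

lemma trace_sqrt_Sigma_m:
  "mat_trace (mat_sqrt (Sigma_m U1 U2 S1 S2)) = (\<Sum>j<p + q. sqrt (a j + b j))"
proof -
  have "transpose_mat (U * W) * (U * W) = mat_diag (p + q) (\<lambda>j. a j + b j)"
    unfolding gram_orthogonal(2)[OF stacked_diag_carrier]
    by (subst stacked_diag_gram) (simp_all add: a b)
  from trace_sqrt_gram_diag[OF mult_carrier_mat[OF u(1) stacked_diag_carrier] this] show ?thesis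
    unfolding Sigma_m_factor gram_orthogonal(1)[OF stacked_diag_carrier] .
qed

text \<open>Multiplying the factor \<open>W\<close> of \<open>\<Sigma>\<^sub>m\<close> by \<open>\<Sigma>\<^sub>0\<^sup>1\<^sup>/\<^sup>2\<close> scales its two diagonals by the square roots
of the eigenvalues once more, so again a stacked diagonal matrix results, now with the eigenvalues
themselves on its diagonals.\<close>

lemma trace_sqrt_fidelity_Sigma_m:
  "mat_trace (mat_sqrt (mat_sqrt (Sigma_zero S1 S2) * Sigma_m U1 U2 S1 S2 * mat_sqrt (Sigma_zero S1 S2))) =
    (\<Sum>j<p + q. sqrt ((a j)\<^sup>2 + (b j)\<^sup>2))"
proof -
  let ?V = "stacked_diag p q a b"
  have W: "W \<in> carrier_mat (p + q) (p + q)" and WT: "transpose_mat W \<in> carrier_mat (p + q) (p + q)" by simp_all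
  have V: "zero_root * W = ?V"
    unfolding zero_root_def mat_diag_mult_left[OF stacked_diag_carrier]
    by (rule eq_matI) (auto simp: stacked_diag_def a(1) b(1))
  have "transpose_mat ?V = transpose_mat W * zero_root"
    unfolding V[symmetric] transpose_mult[OF zero_root_carrier W] by (simp add: zero_root_def)
  then have VV: "zero_root * (W * transpose_mat W) * zero_root = ?V * transpose_mat ?V"
    unfolding V[symmetric] using W WT zero_root_carrier
    by (simp add: assoc_mult_mat[of _ "p + q" "p + q" _ "p + q" _ "p + q"] mult_carrier_square)
  have "transpose_mat (U * ?V) * (U * ?V) = mat_diag (p + q) (\<lambda>j. (a j)\<^sup>2 + (b j)\<^sup>2)"
    unfolding gram_orthogonal(2)[OF stacked_diag_carrier]
    by (rule stacked_diag_gram) (simp_all add: a b)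
  from trace_sqrt_gram_diag[OF mult_carrier_mat[OF u(1) stacked_diag_carrier] this] show ?thesis
    unfolding Sigma_m_factor sqrt_Sigma_zero_conj[OF mult_carrier_mat[OF W WT]] VV
      gram_orthogonal(1)[OF stacked_diag_carrier] .
qed

lemma Gamma_psd_trace:
  assumes "T \<in> Gamma_set S1 S2"
  shows "T \<in> psd_mats (p + q)" "mat_trace T = mat_trace S1 + mat_trace S2"
proof -
  from assms obtain B C where T: "T \<in> psd_mats (p + q)" and TB: "T = four_block_mat S1 B C S2"
    by (auto simp: Gamma_set_def)
  show "T \<in> psd_mats (p + q)" by (rule T)
  show "mat_trace T = mat_trace S1 + mat_trace S2"
    unfolding mat_trace_sum[OF psd_matsD(1)[OF T]] mat_trace_sum[OF s1(1)] mat_trace_sum[OF s2(1)]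
      sum_lessThan_add by (simp add: TB)
qed

lemma Sigma_zero_Gamma: "Sigma_zero S1 S2 \<in> Gamma_set S1 S2"
proof -
  have "Sigma_zero S1 S2 = four_block_mat S1 (0\<^sub>m p q) (0\<^sub>m q p) S2" by (simp add: Sigma_zero_def)
  with Sigma_zero_psd show ?thesis
    unfolding Gamma_set_def dims by (intro CollectI conjI bexI[of _ "0\<^sub>m p q"] bexI[of _ "0\<^sub>m q p"]) auto
qed

lemma bw_dist2_Sigma_zero:
  assumes T: "T \<in> Gamma_set S1 S2"
  shows "bw_dist2 T (Sigma_zero S1 S2) = 2 * (mat_trace S1 + mat_trace S2 -
    mat_trace (mat_sqrt (mat_sqrt (Sigma_zero S1 S2) * T * mat_sqrt (Sigma_zero S1 S2))))"
  unfolding bw_dist2_def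
  by (simp add: Gamma_psd_trace[OF T] Gamma_psd_trace[OF Sigma_zero_Gamma]
      trace_sqrt_fidelity_commute[OF Gamma_psd_trace(1)[OF T] Sigma_zero_psd])

lemma D1_denom_eq:
  "D1_denom S1 S2 = 2 * (mat_trace (mat_sqrt S1) + mat_trace (mat_sqrt S2) - (\<Sum>j<p + q. sqrt (a j + b j)))"
proof -
  have bw: "bw_dist2 T (1\<^sub>m (p + q)) =
      mat_trace S1 + mat_trace S2 + real (p + q) - 2 * mat_trace (mat_sqrt T)"
    if "T \<in> Gamma_set S1 S2" for T
    using bw_dist2_one[OF Gamma_psd_trace(1)[OF that]] Gamma_psd_trace(2)[OF that] by simp
  have "(SUP T\<in>Gamma_set S1 S2. bw_dist2 T (1\<^sub>m (p + q))) =
      mat_trace S1 + mat_trace S2 + real (p + q) - 2 * (\<Sum>j<p + q. sqrt (a j + b j))"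
  proof (rule cSup_eq_maximum)
    show "mat_trace S1 + mat_trace S2 + real (p + q) - 2 * (\<Sum>j<p + q. sqrt (a j + b j))
        \<in> (\<lambda>T. bw_dist2 T (1\<^sub>m (p + q))) ` Gamma_set S1 S2"
      by (rule image_eqI[OF _ Sigma_m_Gamma]) (simp only: bw[OF Sigma_m_Gamma] trace_sqrt_Sigma_m)
  next
    fix x assume "x \<in> (\<lambda>T. bw_dist2 T (1\<^sub>m (p + q))) ` Gamma_set S1 S2"
    then obtain T where "T \<in> Gamma_set S1 S2" "x = bw_dist2 T (1\<^sub>m (p + q))" by blast
    then show "x \<le> mat_trace S1 + mat_trace S2 + real (p + q) - 2 * (\<Sum>j<p + q. sqrt (a j + b j))"
      using trace_sqrt_ge[of T] bw[of T] by simp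
  qed
  then show ?thesis
    unfolding D1_denom_def dims by (simp add: bw_dist2_one[OF S1] bw_dist2_one[OF S2])
qed

lemma D2_denom_eq:
  "D2_denom S1 S2 = 2 * (mat_trace S1 + mat_trace S2 - (\<Sum>j<p + q. sqrt ((a j)\<^sup>2 + (b j)\<^sup>2)))"
  unfolding D2_denom_def
proof (rule cSup_eq_maximum)
  show "2 * (mat_trace S1 + mat_trace S2 - (\<Sum>j<p + q. sqrt ((a j)\<^sup>2 + (b j)\<^sup>2)))
      \<in> (\<lambda>T. bw_dist2 T (Sigma_zero S1 S2)) ` Gamma_set S1 S2"
    by (rule image_eqI[OF _ Sigma_m_Gamma])
      (simp only: bw_dist2_Sigma_zero[OF Sigma_m_Gamma] trace_sqrt_fidelity_Sigma_m)
next
  fix x assume "x \<in> (\<lambda>T. bw_dist2 T (Sigma_zero S1 S2)) ` Gamma_set S1 S2"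
  then obtain T where "T \<in> Gamma_set S1 S2" "x = bw_dist2 T (Sigma_zero S1 S2)" by blast
  then show "x \<le> 2 * (mat_trace S1 + mat_trace S2 - (\<Sum>j<p + q. sqrt ((a j)\<^sup>2 + (b j)\<^sup>2)))"
    using trace_sqrt_fidelity_ge[of T] bw_dist2_Sigma_zero[of T] by simp
qed

end

section \<open>The dependence coefficients\<close>

text \<open>This is where the marginals being non-zero enters: it makes the denominators strictly positive.\<close>

lemma largest_eigval_pos:
  assumes A: "A \<in> psd_mats n" and nz: "A \<noteq> 0\<^sub>m n n"
  shows "0 < eigval A 0"
proof (rule ccontr)
  assume "\<not> ?thesis"
  then have "eigval A 0 = 0" using eigval_psd(1)[OF A, of 0] by simp
  then have "eigval A j = 0" for j
    using eigval_psd(2)[OF A, of 0 j] eigval_psd(1)[OF A, of j] by simp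
  then have "mat_diag n (eigval A) = 0\<^sub>m n n" by (auto simp: mat_diag_def intro!: eq_matI)
  moreover obtain V where "is_eigendecomp A V"
    using symmetric_eigendecomp(2)[OF psd_matsD(1,2)[OF A]] by blast
  note V = is_eigendecompD[OF this psd_matsD(1)[OF A]]
  ultimately have "A = 0\<^sub>m n n" using is_orthogonalD(1,2)[OF V(1)] by (metis V(2) left_mult_zero_mat right_mult_zero_mat)
  with nz show False by simp
qed

theorem proposition3p10:
  fixes p q :: nat and S1 S2 S U1 U2 :: "real mat"
  assumes "p \<ge> 1" and "q \<ge> 1"
    and "S1 \<in> psd_mats p" and "S2 \<in> psd_mats q"
    and "S1 \<noteq> 0\<^sub>m p p" and "S2 \<noteq> 0\<^sub>m q q"
    and "S \<in> Gamma_set S1 S2"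
    and "is_eigendecomp S1 U1" and "is_eigendecomp S2 U2"
  shows
    "(D1_denom S1 S2 \<noteq> 0
      \<and> mat_trace (mat_sqrt S1) + mat_trace (mat_sqrt S2)
          - mat_trace (mat_sqrt (Sigma_m U1 U2 S1 S2)) \<noteq> 0
      \<and> (\<Sum>j<p. sqrt (eigval S1 j)) + (\<Sum>j<q. sqrt (eigval S2 j))
          - (\<Sum>j<max p q. sqrt (eigval S1 j + eigval S2 j)) \<noteq> 0
      \<and> D1 S1 S2 S =
          (mat_trace (mat_sqrt S1) + mat_trace (mat_sqrt S2) - mat_trace (mat_sqrt S))
          / (mat_trace (mat_sqrt S1) + mat_trace (mat_sqrt S2)
              - mat_trace (mat_sqrt (Sigma_m U1 U2 S1 S2)))
      \<and> D1 S1 S2 S =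
          ((\<Sum>j<p. sqrt (eigval S1 j)) + (\<Sum>j<q. sqrt (eigval S2 j))
              - (\<Sum>j<p + q. sqrt (eigval S j)))
          / ((\<Sum>j<p. sqrt (eigval S1 j)) + (\<Sum>j<q. sqrt (eigval S2 j))
              - (\<Sum>j<max p q. sqrt (eigval S1 j + eigval S2 j))))
     \<and>
     (D2_denom S1 S2 \<noteq> 0
      \<and> mat_trace S - mat_trace (mat_sqrt (mat_sqrt (Sigma_zero S1 S2)
            * Sigma_m U1 U2 S1 S2 * mat_sqrt (Sigma_zero S1 S2))) \<noteq> 0
      \<and> (\<Sum>j<p + q. eigval S j)
          - (\<Sum>j<max p q. sqrt ((eigval S1 j)\<^sup>2 + (eigval S2 j)\<^sup>2)) \<noteq> 0
      \<and> D2 S1 S2 S =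
          (mat_trace S - mat_trace (mat_sqrt (mat_sqrt (Sigma_zero S1 S2)
              * S * mat_sqrt (Sigma_zero S1 S2))))
          / (mat_trace S - mat_trace (mat_sqrt (mat_sqrt (Sigma_zero S1 S2)
              * Sigma_m U1 U2 S1 S2 * mat_sqrt (Sigma_zero S1 S2))))
      \<and> D2 S1 S2 S =
          ((\<Sum>j<p + q. eigval S j)
            - (\<Sum>j<p + q. sqrt (eigval (mat_sqrt (Sigma_zero S1 S2)
                * S * mat_sqrt (Sigma_zero S1 S2)) j)))
          / ((\<Sum>j<p + q. eigval S j)
              - (\<Sum>j<max p q. sqrt ((eigval S1 j)\<^sup>2 + (eigval S2 j)\<^sup>2))))"
proof -
  interpret eigendecomposed_marginals p q S1 S2 U1 U2
    using assms by unfold_locales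
  let ?n = "p + q"
  note S = assms(7)
  have pos: "0 < eigval S1 0" "0 < eigval S2 0"
    using largest_eigval_pos[OF S1 assms(5)] largest_eigval_pos[OF S2 assms(6)] by auto
  \<comment> \<open>Eigenvalues are padded by zero, so every sum may run over all \<open>p + q\<close> indices.\<close>
  have pad: "(\<Sum>j<p. g (eigval S1 j)) = (\<Sum>j<?n. g (eigval S1 j))"
    "(\<Sum>j<q. g (eigval S2 j)) = (\<Sum>j<?n. g (eigval S2 j))" if "g 0 = 0" for g :: "real \<Rightarrow> real"
    using that a(3) b(3) by (auto intro!: sum.mono_neutral_left) (metis not_less)+
  have pad_max: "(\<Sum>j<max p q. g (eigval S1 j) (eigval S2 j)) = (\<Sum>j<?n. g (eigval S1 j) (eigval S2 j))"
    if "g 0 0 = 0" for g :: "real \<Rightarrow> real \<Rightarrow> real"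
    using that a(3) b(3) by (intro sum.mono_neutral_left) auto
  have max_add: "(\<Sum>j<max p q. sqrt (eigval S1 j + eigval S2 j)) = (\<Sum>j<?n. sqrt (eigval S1 j + eigval S2 j))"
    by (rule pad_max[of "\<lambda>x y. sqrt (x + y)"]) simp
  have max_sq: "(\<Sum>j<max p q. sqrt ((eigval S1 j)\<^sup>2 + (eigval S2 j)\<^sup>2)) =
      (\<Sum>j<?n. sqrt ((eigval S1 j)\<^sup>2 + (eigval S2 j)\<^sup>2))"
    by (rule pad_max[of "\<lambda>x y. sqrt (x\<^sup>2 + y\<^sup>2)"]) simp
  note tr1 = mat_sqrt_psd(3)[OF S1] and tr2 = mat_sqrt_psd(3)[OF S2]
  note trS = mat_sqrt_psd(3)[OF Gamma_psd_trace(1)[OF S]]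
  have trace_S: "mat_trace S = (\<Sum>j<?n. eigval S j)"
    by (rule mat_sqrt_psd(4)[OF Gamma_psd_trace(1)[OF S]])
  have K: "mat_sqrt (Sigma_zero S1 S2) * S * mat_sqrt (Sigma_zero S1 S2) \<in> psd_mats ?n" (is "?K \<in> _")
    using psd_conj[OF Gamma_psd_trace(1)[OF S] psd_matsD(1)[OF mat_sqrt_psd(1)[OF Sigma_zero_psd]]]
      psd_matsD(2)[OF mat_sqrt_psd(1)[OF Sigma_zero_psd]] by simp
  note trK = mat_sqrt_psd(3)[OF K]
  have less_add: "(\<Sum>j<?n. sqrt (eigval S1 j + eigval S2 j)) <
      mat_trace (mat_sqrt S1) + mat_trace (mat_sqrt S2)"
    unfolding tr1 tr2 pad[of sqrt, OF real_sqrt_zero] sum.distrib[symmetric]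
    by (rule sum_sqrt_add_less) (use a(1) b(1) pos assms(1) in auto)
  have less_sq: "(\<Sum>j<?n. sqrt ((eigval S1 j)\<^sup>2 + (eigval S2 j)\<^sup>2)) < mat_trace S"
  proof -
    have "(\<Sum>j<?n. sqrt ((eigval S1 j)\<^sup>2 + (eigval S2 j)\<^sup>2)) <
        (\<Sum>j<?n. sqrt ((eigval S1 j)\<^sup>2) + sqrt ((eigval S2 j)\<^sup>2))"
      by (rule sum_sqrt_add_less) (use pos assms(1) in auto)
    also have "\<dots> = (\<Sum>j<?n. eigval S1 j) + (\<Sum>j<?n. eigval S2 j)"
      using a(1) b(1) by (simp add: sum.distrib)
    also have "\<dots> = mat_trace S"
      using Gamma_psd_trace(2)[OF S] mat_sqrt_psd(4)[OF S1] mat_sqrt_psd(4)[OF S2]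
        pad[of "\<lambda>x. x"] by simp
    finally show ?thesis .
  qed
  have D1: "D1 S1 S2 S =
      (mat_trace (mat_sqrt S1) + mat_trace (mat_sqrt S2) - mat_trace (mat_sqrt S)) /
      (mat_trace (mat_sqrt S1) + mat_trace (mat_sqrt S2) - (\<Sum>j<?n. sqrt (eigval S1 j + eigval S2 j)))"
  proof -
    have "bw_dist2 S (1\<^sub>m (dim_row S1 + dim_row S2)) - bw_dist2 S1 (1\<^sub>m (dim_row S1))
        - bw_dist2 S2 (1\<^sub>m (dim_row S2)) =
        2 * (mat_trace (mat_sqrt S1) + mat_trace (mat_sqrt S2) - mat_trace (mat_sqrt S))"
      unfolding dims bw_dist2_one[OF S1] bw_dist2_one[OF S2] bw_dist2_one[OF Gamma_psd_trace(1)[OF S]]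
        Gamma_psd_trace(2)[OF S] by simp
    then show ?thesis
      unfolding D1_def D1_denom_eq by (simp only: mult_divide_mult_cancel_left[OF zero_neq_numeral[symmetric]])
  qed
  have D2: "D2 S1 S2 S = (mat_trace S - mat_trace (mat_sqrt ?K)) /
      (mat_trace S - (\<Sum>j<?n. sqrt ((eigval S1 j)\<^sup>2 + (eigval S2 j)\<^sup>2)))"
    unfolding D2_def D2_denom_eq bw_dist2_Sigma_zero[OF S] Gamma_psd_trace(2)[OF S]
    by (simp only: mult_divide_mult_cancel_left[OF zero_neq_numeral[symmetric]])
  have "D1_denom S1 S2 \<noteq> 0" "D2_denom S1 S2 \<noteq> 0"
    using less_add less_sq unfolding D1_denom_eq D2_denom_eq Gamma_psd_trace(2)[OF S] by auto
  then show ?thesis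
    using less_add less_sq
    unfolding D1 D2 trace_sqrt_Sigma_m trace_sqrt_fidelity_Sigma_m max_add max_sq
      trS[symmetric] trK[symmetric] trace_S[symmetric] tr1[symmetric] tr2[symmetric]
    by simp
qed

end
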